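(* If $n\geq 3589$ and $3\leq k\leq n-3$, then there exists a matroid of rank $k$ and cardinality $n$ that is not Ehrhart positive. Moreover, if $n\geq 104$ and $4\leq k\leq n-4$, then there exists a matroid of rank $k$ and cardinality $n$ that is not Ehrhart positive.
   Context: For a matroid $\mathsf{M}$ on $E=\{1,\ldots,n\}$ with set of bases $\mathscr{B}$, the base polytope is $\mathscr{P}(\mathsf{M})=\operatorname{conv}\{e_B : B\in\mathscr{B}\}\subseteq\mathbb{R}^n$, where $e_B=\sum_{i\in B}e_i$ and $e_i$ is the $i$-th canonical basis vector. The cardinality of a matroid is the cardinality of its ground set. The Ehrhart polynomial $\operatorname{ehr}(\mathsf{M},t)$ is the polynomial of degree $\dim\mathscr{P}(\mathsf{M})$ with $\operatorname{ehr}(\mathsf{M},t)=\#(t\mathscr{P}(\mathsf{M})\cap\mathbb{Z}^n)$ for all nonnegative integers $t$. The matroid $\mathsf{M}$ is Ehrhart positive if all coefficients of $\operatorname{ehr}(\mathsf{M},t)$ (in degrees $0,\ldots,\dim\mathscr{P}(\mathsf{M})$) are positive. *)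

theory Defs
  imports "HOL-Analysis.Analysis" "HOL-Computational_Algebra.Polynomial"
begin

text \<open>A matroid on the finite ground set \<open>E\<close>, given by its set \<open>\<B>\<close> of bases.\<close>

locale matroid =
  fixes E :: "'a set" and \<B> :: "'a set set"
  assumes finite_ground: "finite E"
    and bases_subset: "B \<in> \<B> \<Longrightarrow> B \<subseteq> E"
    and bases_nonempty: "\<B> \<noteq> {}"
    and basis_exchange:
      "\<lbrakk>B\<^sub>1 \<in> \<B>; B\<^sub>2 \<in> \<B>; x \<in> B\<^sub>1 - B\<^sub>2\<rbrakk> \<Longrightarrow> \<exists>y \<in> B\<^sub>2 - B\<^sub>1. insert y (B\<^sub>1 - {x}) \<in> \<B>"
begin

lemma finite_basis: "B \<in> \<B> \<Longrightarrow> finite B"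
  using bases_subset finite_ground finite_subset by blast

lemma card_basis_le: "\<lbrakk>B\<^sub>1 \<in> \<B>; B\<^sub>2 \<in> \<B>\<rbrakk> \<Longrightarrow> card B\<^sub>1 \<le> card B\<^sub>2"
proof (induction "card (B\<^sub>1 - B\<^sub>2)" arbitrary: B\<^sub>1 rule: less_induct)
  case less
  show ?case
  proof (cases "B\<^sub>1 \<subseteq> B\<^sub>2")
    case True
    then show ?thesis using finite_basis less.prems by (simp add: card_mono)
  next
    case False
    then obtain x where x: "x \<in> B\<^sub>1 - B\<^sub>2" by blast
    then obtain y where y: "y \<in> B\<^sub>2 - B\<^sub>1" and B: "insert y (B\<^sub>1 - {x}) \<in> \<B>"
      using basis_exchange[OF less.prems x] by blast
    have "insert y (B\<^sub>1 - {x}) - B\<^sub>2 = (B\<^sub>1 - B\<^sub>2) - {x}" using y by auto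
    then have "card (insert y (B\<^sub>1 - {x}) - B\<^sub>2) < card (B\<^sub>1 - B\<^sub>2)"
      using x finite_basis[OF less.prems(1)] card_Diff1_less[of "B\<^sub>1 - B\<^sub>2" x] by simp
    then have "card (insert y (B\<^sub>1 - {x})) \<le> card B\<^sub>2"
      by (rule less.hyps[OF _ B less.prems(2)])
    moreover have "card (insert y (B\<^sub>1 - {x})) = card B\<^sub>1"
      using x y finite_basis[OF less.prems(1)] card_Suc_Diff1[of B\<^sub>1 x] by auto
    ultimately show ?thesis by simp
  qed
qed

lemma card_basis_eq: "\<lbrakk>B\<^sub>1 \<in> \<B>; B\<^sub>2 \<in> \<B>\<rbrakk> \<Longrightarrow> card B\<^sub>1 = card B\<^sub>2"
  by (simp add: antisym card_basis_le)

end

definition matroid_rank :: "'a set set \<Rightarrow> nat" where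
  "matroid_rank \<B> = card (SOME B. B \<in> \<B>)"

lemma (in matroid) matroid_rank_eq: "B \<in> \<B> \<Longrightarrow> matroid_rank \<B> = card B"
  unfolding matroid_rank_def using card_basis_eq by (meson someI)

text \<open>
  From here on the ground set is the whole of a finite type \<open>'n\<close>, which plays the role of
  \<open>{1, \<dots>, n}\<close> with \<open>n = CARD('n)\<close>, so that the ambient space \<open>real ^ 'n\<close> is \<open>n\<close>-dimensional
  Euclidean space.
\<close>

definition incidence_vector :: "'n::finite set \<Rightarrow> real ^ 'n" where
  "incidence_vector B = (\<Sum>i\<in>B. axis i 1)"

definition base_polytope :: "'n::finite set set \<Rightarrow> (real ^ 'n) set" where
  "base_polytope \<B> = convex hull (incidence_vector ` \<B>)"

definition integer_points :: "(real ^ 'n::finite) set" where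
  "integer_points = {x. \<forall>i. x $ i \<in> \<int>}"

definition is_ehrhart_polynomial :: "'n::finite set set \<Rightarrow> real poly \<Rightarrow> bool" where
  "is_ehrhart_polynomial \<B> p \<longleftrightarrow>
     int (degree p) = aff_dim (base_polytope \<B>) \<and>
     (\<forall>t::nat. poly p (real t) =
        real (card ((\<lambda>x. real t *\<^sub>R x) ` base_polytope \<B> \<inter> integer_points)))"

lemma is_ehrhart_polynomial_unique:
  assumes "is_ehrhart_polynomial \<B> p" and "is_ehrhart_polynomial \<B> q"
  shows "p = q"
proof -
  have "range real \<subseteq> {x. poly (p - q) x = 0}"
    using assms unfolding is_ehrhart_polynomial_def by auto
  moreover have "infinite (range real)"
    using finite_imageD infinite_UNIV_nat inj_of_nat by blast
  ultimately have "infinite {x. poly (p - q) x = 0}"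
    using finite_subset by blast
  then show ?thesis
    using poly_roots_finite[of "p - q"] by auto
qed

text \<open>
  Existence for the bases of a matroid is Ehrhart's theorem, as the base polytope has integral
  vertices; uniqueness is \<open>is_ehrhart_polynomial_unique\<close>.
\<close>

definition ehrhart_polynomial :: "'n::finite set set \<Rightarrow> real poly" where
  "ehrhart_polynomial \<B> = (THE p. is_ehrhart_polynomial \<B> p)"

lemma ehrhart_polynomial_eqI:
  "is_ehrhart_polynomial \<B> p \<Longrightarrow> ehrhart_polynomial \<B> = p"
  unfolding ehrhart_polynomial_def by (rule the_equality) (auto intro: is_ehrhart_polynomial_unique)

definition ehrhart_positive :: "'n::finite set set \<Rightarrow> bool" where
  "ehrhart_positive \<B> \<longleftrightarrow>
     (\<forall>i. int i \<le> aff_dim (base_polytope \<B>) \<longrightarrow> coeff (ehrhart_polynomial \<B>) i > 0)"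

end

theory Submission
  imports Defs "HOL-Computational_Algebra.Formal_Power_Series"
begin

text \<open>
  Let \<open>F\<close> have \<open>n\<close> elements and let \<open>\<H>\<close> be a family of \<open>k\<close>-subsets of \<open>F\<close>, any two of which
  share at most \<open>k - 2\<close> elements. The \<open>k\<close>-subsets outside \<open>\<H>\<close> are the bases of a sparse paving
  matroid, whose polytope is the hypersimplex cut by the inequalities \<open>x(H) \<le> k - 1\<close>, \<open>H \<in> \<H>\<close>.
  In a dilate, the parts cut off by different \<open>H\<close> are disjoint and contain equally many lattice
  points, so the Ehrhart polynomial is that of the hypersimplex minus \<open>card \<H>\<close> times a fixed
  polynomial. With \<open>card \<H> \<ge> (n choose k) / n\<close> (Graham and Sloane) the cubic coefficient becomes
  negative for \<open>(k, n) = (3, 3589), (4, 104), (5, 57)\<close>. Loops and coloops do not change the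
  Ehrhart polynomial, nor does duality, and these operations turn the three matroids into matroids
  of all the required ranks and cardinalities.
\<close>

section \<open>Lattice points of dilated hypersimplices\<close>

text \<open>Negativity is a race between logarithms and powers. The cubic coefficient of the
  hypersimplex polynomial has order at most (log n)^3 for fixed \<open>k\<close>, since it is
  governed by elementary symmetric functions of 1, 1/2, ..., 1/N. In the subtracted term the factor
  (n choose k) / n cancels the normalisation of \<open>excess_poly\<close>, and what remains grows
  like n^(k-2) log n. The exponent is 1 for k = 3, so rank 3 needs thousands of elements; rank 4
  needs about a hundred and rank 5 fewer still. Rank 5 serves to fill the middle ranks. Loops and
  coloops turn rank \<open>k0\<close> and corank \<open>m\<close> into any larger rank and corank,
  and duality swaps the two, so the pair (4, 100) alone leaves a gap between 4 and n - 4. The pair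
  (5, 52) closes it because 52 + 52 <= 104. The Ehrhart polynomial must also have degree equal to
  the dimension. Correct values at all \<open>t\<close> do not show this by themselves, so the
  leading coefficients are computed and compared too.\<close>

text \<open>Each element of \<open>A\<close> contributes a factor 1 + X + ... + X^t; splitting off
  the value at one element is the Cauchy product.\<close>

lemma card_bounded_compositions_fps:
  fixes A :: "'a set"
  assumes "finite A"
  shows "real (card {f \<in> A \<rightarrow>\<^sub>E {..t}. sum f A = s}) = fps_nth ((\<Sum>i\<le>t. fps_X ^ i) ^ card A) s"
  using assms
proof (induction A arbitrary: s rule: finite_induct)
  case empty
  then show ?case by simp
next
  case (insert a A)
  define G where "G s = {f \<in> A \<rightarrow>\<^sub>E {..t}. sum f A = s}" for s
  have finG: "finite (G s)" for s
    unfolding G_def using insert.hyps by (auto intro!: finite_PiE finite_Collect_conjI)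
  let ?u = "\<lambda>(i, g). g(a := i)"
  have "{f \<in> insert a A \<rightarrow>\<^sub>E {..t}. sum f (insert a A) = s} =
      ?u ` (SIGMA i:{i. i \<le> t \<and> i \<le> s}. G (s - i))" (is "?L = ?R")
  proof (intro equalityI subsetI)
    fix f assume f: "f \<in> ?L"
    then obtain i g where ig: "f = g(a := i)" "i \<le> t" "g \<in> A \<rightarrow>\<^sub>E {..t}"
      by (auto simp: PiE_insert_eq)
    have "sum f (insert a A) = i + sum g A"
      using insert.hyps ig by (auto intro!: sum.cong)
    then show "f \<in> ?R" using f ig by (intro image_eqI[of _ _ "(i, g)"]) (auto simp: G_def)
  next
    fix f assume "f \<in> ?R"
    then obtain i g where ig: "f = g(a := i)" "i \<le> t" "i \<le> s" "g \<in> G (s - i)" by auto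
    have "sum f (insert a A) = i + sum g A"
      using insert.hyps ig by (auto intro!: sum.cong)
    then show "f \<in> ?L" using ig by (auto simp: G_def PiE_insert_eq)
  qed
  moreover have "inj_on ?u (SIGMA i:{i. i \<le> t \<and> i \<le> s}. G (s - i))"
  proof (rule inj_onI, clarify)
    fix i g j h assume gh: "g \<in> G (s - i)" "h \<in> G (s - j)" and eq: "g(a := i) = h(a := j)"
    have "g a = h a" using gh insert.hyps by (auto simp: G_def PiE_def extensional_def)
    then show "i = j \<and> g = h" using eq by (metis fun_upd_same fun_upd_triv fun_upd_upd)
  qed
  ultimately have "card {f \<in> insert a A \<rightarrow>\<^sub>E {..t}. sum f (insert a A) = s} =
      (\<Sum>i\<in>{i. i \<le> t \<and> i \<le> s}. card (G (s - i)))"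
    by (simp add: card_image finG)
  also have "real \<dots> = (\<Sum>i\<le>t. if s < i then 0 else fps_nth ((\<Sum>i\<le>t. fps_X ^ i) ^ card A) (s - i))"
    using insert.IH by (auto simp: G_def of_nat_sum not_less intro!: sum.mono_neutral_cong_left split: if_splits)
  also have "\<dots> = fps_nth ((\<Sum>i\<le>t. fps_X ^ i) ^ card (insert a A)) s"
    using insert.hyps by (simp add: sum_distrib_right fps_sum_nth fps_X_power_mult_nth)
  finally show ?case .
qed

lemma fps_nth_inverse_one_minus_X_power:
  "fps_nth (inverse ((1 - fps_X) ^ Suc n)) i = real ((n + i) choose n)"
proof -
  have "(inverse ((1 - fps_X) ^ Suc n) :: real fps) = Abs_fps (\<lambda>i. real ((n + i) choose i))"
    using one_minus_const_fps_X_neg_power'[of "Suc n" "1 :: real"] by simp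
  then show ?thesis by (simp add: binomial_symmetric[of i])
qed

text \<open>Since 1 + X + ... + X^t = (1 - X^(t+1)) / (1 - X), the power of the numerator is
  expanded binomially and that of the denominator by the negative binomial series. This is
  inclusion-exclusion over the coordinates exceeding \<open>t\<close>.\<close>

lemma card_bounded_compositions:
  assumes "finite A" "card A = Suc n"
  shows "real (card {f \<in> A \<rightarrow>\<^sub>E {..t}. sum f A = s}) =
    (\<Sum>j\<le>Suc n. (- 1) ^ j * (Suc n choose j) *
      (if s < j * Suc t then 0 else real ((n + (s - j * Suc t)) choose n)))"
proof -
  have "(1 - fps_X) * (\<Sum>i\<le>t. fps_X ^ i) = (1 - fps_X ^ Suc t :: real fps)"
    by (rule sum_gp_basic)
  then have *: "(1 - fps_X) ^ Suc n * (\<Sum>i\<le>t. fps_X ^ i) ^ Suc n = ((1 - fps_X ^ Suc t) ^ Suc n :: real fps)"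
    by (simp only: power_mult_distrib[symmetric])
  have **: "inverse ((1 - fps_X) ^ Suc n) * (1 - fps_X) ^ Suc n = (1 :: real fps)"
    by (rule inverse_mult_eq_1) simp
  have "(\<Sum>i\<le>t. fps_X ^ i) ^ Suc n =
      inverse ((1 - fps_X) ^ Suc n) * ((1 - fps_X ^ Suc t) ^ Suc n :: real fps)"
    unfolding *[symmetric] mult.assoc[symmetric] ** by (rule mult_1_left[symmetric])
  also have "(1 - fps_X ^ Suc t) ^ Suc n = (- (fps_X ^ Suc t) + 1 :: real fps) ^ Suc n" by simp
  also have "\<dots> = (\<Sum>j\<le>Suc n. of_nat (Suc n choose j) * (- (fps_X ^ Suc t)) ^ j)"
    by (subst binomial_ring) simp
  also have "\<dots> = (\<Sum>j\<le>Suc n. fps_const ((- 1) ^ j * real (Suc n choose j)) * fps_X ^ (j * Suc t))"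
  proof (intro sum.cong refl)
    fix j
    have "(- (fps_X ^ Suc t)) ^ j = ((- 1) ^ j * fps_X ^ (j * Suc t) :: real fps)"
      by (subst power_minus) (simp only: power_mult[symmetric] mult.commute[of j])
    moreover have "fps_const ((- 1) ^ j) = ((- 1) ^ j :: real fps)"
      by (simp only: fps_const_power[symmetric] fps_const_neg[symmetric] fps_const_1_eq_1)
    ultimately show "of_nat (Suc n choose j) * (- (fps_X ^ Suc t)) ^ j =
        fps_const ((- 1) ^ j * real (Suc n choose j)) * fps_X ^ (j * Suc t)"
      by (simp only: fps_const_mult[symmetric] fps_of_nat mult_ac)
  qed
  finally have "((\<Sum>i\<le>t. fps_X ^ i) ^ Suc n :: real fps) =
    (\<Sum>j\<le>Suc n. fps_const ((- 1) ^ j * real (Suc n choose j)) *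
      (fps_X ^ (j * Suc t) * inverse ((1 - fps_X) ^ Suc n)))"
    by (simp only: sum_distrib_left mult_ac)
  then show ?thesis
    by (simp add: card_bounded_compositions_fps assms fps_sum_nth fps_X_power_mult_nth
        fps_nth_inverse_one_minus_X_power cong: if_cong del: power_Suc mult_Suc_right)
qed

section \<open>Katzman's formula for hypersimplices\<close>

definition binomial_poly :: "real \<Rightarrow> real \<Rightarrow> nat \<Rightarrow> real poly" where
  "binomial_poly a c m = smult (1 / fact m) (\<Prod>i<m. [:c - real i, a:])"

lemma poly_binomial_poly: "poly (binomial_poly a c m) x = (c + a * x) gchoose m"
  by (simp add: binomial_poly_def poly_prod gbinomial_prod_rev atLeast0LessThan algebra_simps)

lemma poly_binomial_poly_nat:
  "real N = c + a * x \<Longrightarrow> poly (binomial_poly a c m) x = real (N choose m)"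
  by (metis poly_binomial_poly binomial_gbinomial)

text \<open>Katzman's formula for the Ehrhart polynomial of the hypersimplex, each binomial
  coefficient being read as a polynomial in \<open>t\<close>.\<close>

definition hypersimplex_poly :: "nat \<Rightarrow> nat \<Rightarrow> real poly" where
  "hypersimplex_poly k n =
    (\<Sum>j<k. smult ((- 1) ^ j * real (n choose j)) (binomial_poly (real k - real j) (real n - 1 - real j) (n - 1)))"

lemma card_hypersimplex_points:
  assumes "finite A" "1 \<le> k" "k \<le> card A"
  shows "real (card {f \<in> A \<rightarrow>\<^sub>E {..t}. sum f A = k * t}) = poly (hypersimplex_poly k (card A)) t"
proof -
  obtain n where n: "card A = Suc n" using assms by (cases "card A") auto
  have "real (card {f \<in> A \<rightarrow>\<^sub>E {..t}. sum f A = k * t}) =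
      (\<Sum>j\<le>Suc n. (- 1) ^ j * (Suc n choose j) *
      (if k * t < j * Suc t then 0 else real ((n + (k * t - j * Suc t)) choose n)))"
    by (rule card_bounded_compositions[OF assms(1) n])
  also have "\<dots> = (\<Sum>j<k. (- 1) ^ j * (Suc n choose j) *
      (if k * t < j * Suc t then 0 else real ((n + (k * t - j * Suc t)) choose n)))"
  proof (intro sum.mono_neutral_right ballI)
    fix j assume "j \<in> {..Suc n} - {..<k}"
    then have "k * t \<le> j * t" "1 \<le> j" using assms by auto
    then have "k * t < j * Suc t" unfolding mult_Suc_right by linarith
    then show "(- 1) ^ j * (Suc n choose j) *
      (if k * t < j * Suc t then 0 else real ((n + (k * t - j * Suc t)) choose n)) = 0" by simp
  qed (use assms n in auto)
  also have "\<dots> = (\<Sum>j<k. (- 1) ^ j * (Suc n choose j) *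
      poly (binomial_poly (real k - real j) (real n - real j) n) t)"
  proof (intro sum.cong refl arg_cong2[of _ _ _ _ "(*)"])
    fix j assume "j \<in> {..<k}"
    then have j: "j < k" "j \<le> n" "j * t \<le> k * t" using assms n by auto
    have "real ((k - j) * t + n - j) = real n - real j + (real k - real j) * real t"
      by (simp only: diff_add_assoc[OF j(2)] of_nat_add of_nat_mult of_nat_diff[OF j(2)]
          of_nat_diff[OF less_imp_le[OF j(1)]])
    from poly_binomial_poly_nat[OF this, of n]
    have "poly (binomial_poly (real k - real j) (real n - real j) n) t = real ((k - j) * t + n - j choose n)" .
    moreover have "(if k * t < j * Suc t then 0 else real ((n + (k * t - j * Suc t)) choose n)) =
        real ((k - j) * t + n - j choose n)"
    proof (cases "k * t < j * Suc t")
      case True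
      moreover have "(k - j) * t + j * t = k * t"
        using j by (metis add_mult_distrib le_add_diff_inverse2 less_imp_le)
      ultimately have "(k - j) * t < j" unfolding mult_Suc_right by linarith
      then have "(k - j) * t + n - j < n" using j by linarith
      then show ?thesis using True by (simp add: binomial_eq_0)
    next
      case False
      then have "n + (k * t - j * Suc t) = (k - j) * t + n - j" using j by (simp add: diff_mult_distrib)
      then show ?thesis using False by simp
    qed
    ultimately show "(if k * t < j * Suc t then 0 else real ((n + (k * t - j * Suc t)) choose n)) =
        poly (binomial_poly (real k - real j) (real n - real j) n) t" by simp
  qed
  finally show ?thesis by (simp add: hypersimplex_poly_def poly_sum n)
qed

text \<open>A total \<open>s <= t\<close> makes the bound \<open>t\<close> on the values vacuous;
  only \<open>j = 0\<close> survives and stars and bars remains.\<close>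

lemma card_compositions:
  assumes "finite A" "A \<noteq> {}" "s \<le> t"
  shows "card {f \<in> A \<rightarrow>\<^sub>E {..t}. sum f A = s} = (s + card A - 1) choose (card A - 1)"
proof -
  obtain n where n: "card A = Suc n" using assms by (cases "card A") auto
  have "real (card {f \<in> A \<rightarrow>\<^sub>E {..t}. sum f A = s}) =
      (\<Sum>j\<in>{0}. (- 1) ^ j * (Suc n choose j) *
      (if s < j * Suc t then 0 else real ((n + (s - j * Suc t)) choose n)))"
    unfolding card_bounded_compositions[OF assms(1) n]
  proof (intro sum.mono_neutral_right ballI)
    fix j assume "j \<in> {..Suc n} - {0}"
    then have "1 * Suc t \<le> j * Suc t" by (intro mult_le_mono1) auto
    then show "(- 1) ^ j * (Suc n choose j) *
      (if s < j * Suc t then 0 else real ((n + (s - j * Suc t)) choose n)) = 0" using assms by simp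
  qed auto
  then show ?thesis by (simp add: n add.commute)
qed

section \<open>The part cut off by one circuit-hyperplane\<close>

text \<open>This is the Ehrhart polynomial, evaluated at \<open>t - 1\<close>, of the graphic
  matroid of a (k+1)-cycle with one edge replaced by \<open>m\<close> parallel edges. The product
  form gives access to the coefficients, which the sum in \<open>poly_excess_poly\<close>
  hides.\<close>

definition excess_poly :: "nat \<Rightarrow> nat \<Rightarrow> real poly" where
  "excess_poly k m = smult (1 / real (m + k - 1 choose (k - 1))) (binomial_poly 1 (real m - 1) m *
     (\<Sum>j<k. smult (real (m - 1 + j choose j)) (binomial_poly 1 (real j - 1) j)))"

text \<open>Telescoping in \<open>t\<close>: the closed form vanishes at 0 and its increments are
  the summands. The formula for the increment is itself proved by induction on
  \<open>k\<close>.\<close>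

lemma poly_excess_poly:
  assumes "k \<ge> 1" "m \<ge> 1"
  shows "poly (excess_poly k m) (real t) =
    (\<Sum>s<t. real (s + k - 1 choose (k - 1)) * real (s + m - 1 choose (m - 1)))"
proof -
  have b: "poly (binomial_poly 1 (real j - 1) j) (real t) = (if j = 0 then 1 else real (t + j - 1 choose j))" for j t
  proof (cases j)
    case 0
    then show ?thesis by (simp add: binomial_poly_def)
  next
    case (Suc i)
    then show ?thesis by (intro trans[OF poly_binomial_poly_nat[of "t + i"]]) auto
  qed
  define P where "P k t = real (t + m - 1 choose m) *
     (\<Sum>j<k. real (m - 1 + j choose j) * (if j = 0 then 1 else real (t + j - 1 choose j)))" for k t
  have absorb: "real (a + b choose b) * real b = real (a + b - 1 choose (b - 1)) * (real a + real b)"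
    if "b \<ge> 1" for a b
    using that times_binomial_minus1_eq[of b "a + b"]
    by (simp add: mult.commute flip: of_nat_mult of_nat_add)
  have absorb': "real (a + b - 1 choose b) * real b = real (a + b - 1 choose (b - 1)) * real a"
    if "b \<ge> 1" for a b
    using that Suc_times_binomial_add[of "b - 1" "a - 1"]
    by (cases a; cases b) (simp_all add: mult.commute add.commute flip: of_nat_mult of_nat_add of_nat_Suc)
  have step: "P k (Suc t) - P k t =
     real (m + k - 1 choose (k - 1)) * (real (t + k - 1 choose (k - 1)) * real (t + m - 1 choose (m - 1)))" for t
    using \<open>k \<ge> 1\<close>
  proof (induction k rule: dec_induct)
    case base
    show ?case using binomial_Suc_Suc[of "t + m - 1" "m - 1"] \<open>m \<ge> 1\<close> by (simp add: P_def)
  next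
    case (step k)
    define x where "x = real (t + m - 1 choose (m - 1))"
    define y where "y = real (t + k - 1 choose (k - 1))"
    define c where "c = real (m + k - 1 choose (k - 1))"
    define u where "u = real m"
    define v where "v = real k"
    have uv: "u > 0" "v > 0" using step.hyps \<open>m \<ge> 1\<close> by (simp_all add: u_def v_def)
    \<comment> \<open>Absorption reduces all shifted binomial coefficients to rational multiples of
      \<open>x\<close>, \<open>y\<close> and \<open>c\<close>; the induction step becomes an
      identity of rational functions in \<open>t\<close>, \<open>u\<close>,
      \<open>v\<close>.\<close>
    have X: "real (t + m choose m) = x * (t + u) / u" "real (t + m - 1 choose m) = x * t / u"
      using absorb[of m t] absorb'[of m t] uv \<open>m \<ge> 1\<close> by (simp_all add: x_def u_def field_simps)
    have Y: "real (t + k choose k) = y * (t + v) / v" "real (t + k - 1 choose k) = y * t / v"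
      using absorb[of k t] absorb'[of k t] uv step.hyps by (simp_all add: y_def v_def field_simps)
    have D: "real (m + k choose k) = c * (u + v) / v" "real (m + k - 1 choose k) = c * u / v"
      using absorb[of k m] absorb'[of k m] uv step.hyps by (simp_all add: c_def u_def v_def field_simps)
    have P: "P (Suc k) t = P k t + real (t + m - 1 choose m) * (real (m + k - 1 choose k) * real (t + k - 1 choose k))" for t
    proof -
      have "m - 1 + k = m + k - 1" using \<open>m \<ge> 1\<close> by simp
      then show ?thesis using step.hyps by (simp add: P_def distrib_left)
    qed
    have "P (Suc k) (Suc t) = P k (Suc t) + x * (t + u) / u * (c * u / v * (y * (t + v) / v))"
      using P[of "Suc t"] X Y D by simp
    moreover have "P (Suc k) t = P k t + x * t / u * (c * u / v * (y * t / v))"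
      using P[of t] X Y D by simp
    moreover have "P k (Suc t) - P k t = c * (y * x)"
      using step.IH by (simp add: c_def y_def x_def)
    moreover have "c * (y * x) + x * (t + u) / u * (c * u / v * (y * (t + v) / v)) -
        x * t / u * (c * u / v * (y * t / v)) = c * (u + v) / v * (y * (t + v) / v * x)"
      using uv by (simp add: field_simps)
    ultimately have "P (Suc k) (Suc t) - P (Suc k) t = c * (u + v) / v * (y * (t + v) / v * x)"
      by linarith
    then show ?case using D Y by (simp add: x_def)
  qed
  have "P k t = real (m + k - 1 choose (k - 1)) *
    (\<Sum>s<t. real (s + k - 1 choose (k - 1)) * real (s + m - 1 choose (m - 1)))"
  proof (induction t)
    case 0
    then show ?case using assms by (simp add: P_def binomial_eq_0)
  next
    case (Suc t)
    then show ?case using step[of t] by (simp add: algebra_simps)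
  qed
  moreover have "real (m + k - 1 choose (k - 1)) \<noteq> 0" using assms by simp
  ultimately show ?thesis using assms
    by (simp add: excess_poly_def poly_sum b P_def del: of_nat_sum)
qed

text \<open>Replacing \<open>f i\<close> by \<open>t - f i\<close> on \<open>H\<close> makes both halves of \<open>f\<close> compositions of one number \<open>s < t\<close>,
  and the bounds by \<open>t\<close> become void.\<close>

lemma card_excess_points:
  assumes "finite F" "H \<subseteq> F" "card H = k" "1 \<le> k" "k < card F"
  shows "real (card {f \<in> F \<rightarrow>\<^sub>E {..t}. sum f F = k * t \<and> (k - 1) * t < sum f H}) =
    poly (excess_poly k (card F - k)) (real t)"
proof -
  define G where "G s = {g \<in> H \<rightarrow>\<^sub>E {..t}. sum g H = s}" for s
  define K where "K s = {g \<in> (F - H) \<rightarrow>\<^sub>E {..t}. sum g (F - H) = s}" for s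
  have fin: "finite H" "finite (F - H)" using assms finite_subset by blast+
  have cFH: "card (F - H) = card F - k" using assms fin by (simp add: card_Diff_subset)
  have finG: "finite (G s)" "finite (K s)" for s
    unfolding G_def K_def using fin by (auto intro!: finite_PiE finite_Collect_conjI)
  have split: "sum f F = sum f H + sum f (F - H)" for f :: "'a \<Rightarrow> nat"
    using assms by (metis add.commute sum.subset_diff)
  have compl: "(\<Sum>i\<in>H. t - f i) + sum f H = k * t" if "\<And>i. i \<in> H \<Longrightarrow> f i \<le> t" for f :: "'a \<Rightarrow> nat"
  proof -
    have "(\<Sum>i\<in>H. t - f i) + sum f H = (\<Sum>i\<in>H. t)"
      unfolding sum.distrib[symmetric] using that by (intro sum.cong) auto
    then show ?thesis using assms by simp
  qed
  have kt: "k * t = (k - 1) * t + t" using \<open>1 \<le> k\<close> by (cases k) auto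
  define a where "a f = (\<lambda>i\<in>H. t - f i, restrict f (F - H))" for f :: "'a \<Rightarrow> nat"
  define b where "b = (\<lambda>(g, h). \<lambda>i\<in>F. if i \<in> H then t - g i else h i :: nat)"
  have "bij_betw a {f \<in> F \<rightarrow>\<^sub>E {..t}. sum f F = k * t \<and> (k - 1) * t < sum f H} (\<Union>s<t. G s \<times> K s)" (is "bij_betw a ?L ?R")
  proof (rule bij_betwI[where g = b])
    show "a \<in> ?L \<rightarrow> ?R"
    proof
      fix f assume f: "f \<in> ?L"
      define s where "s = (\<Sum>i\<in>H. t - f i)"
      have le: "f i \<le> t" if "i \<in> F" for i using f that by auto
      then have "s + sum f H = k * t" unfolding s_def using assms by (intro compl) auto
      then have "s < t" "sum f (F - H) = s" using f split[of f] kt by auto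
      moreover have "(\<lambda>i\<in>H. t - f i) \<in> G s" by (simp add: G_def s_def)
      moreover have "restrict f (F - H) \<in> K (sum f (F - H))" using le by (auto simp: K_def)
      ultimately show "a f \<in> ?R" by (auto simp: a_def)
    qed
    show "b \<in> ?R \<rightarrow> ?L"
    proof
      fix p assume "p \<in> ?R"
      then obtain s g h where p: "p = (g, h)" "s < t" "g \<in> G s" "h \<in> K s" by blast
      define f where "f = b p"
      have g: "g i \<le> t" if "i \<in> H" for i using p that by (auto simp: G_def)
      have h: "h i \<le> t" if "i \<in> F - H" for i using p that by (auto simp: K_def)
      have f: "f \<in> F \<rightarrow>\<^sub>E {..t}" using h by (auto simp: f_def b_def p)
      have "sum f H = (\<Sum>i\<in>H. t - g i)" "sum f (F - H) = sum h (F - H)"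
        using assms by (auto simp: f_def b_def p intro!: sum.cong)
      then have "sum f H + s = k * t" "sum f (F - H) = s"
        using compl[of g, OF g] p by (auto simp: G_def K_def)
      then have "sum f F = k * t" "(k - 1) * t < sum f H"
        using split[of f] kt \<open>s < t\<close> by auto
      then show "b p \<in> ?L" using f by (simp add: f_def)
    qed
    show "b (a f) = f" if "f \<in> ?L" for f
      using that assms by (auto simp: a_def b_def fun_eq_iff PiE_def extensional_def Pi_def)
    show "a (b p) = p" if "p \<in> ?R" for p
    proof -
      from that obtain s g h where p: "p = (g, h)" "g \<in> G s" "h \<in> K s" by blast
      have "(\<lambda>i\<in>H. t - b p i) = g"
        using p assms by (auto simp: b_def fun_eq_iff G_def PiE_def extensional_def Pi_def)
      moreover have "restrict (b p) (F - H) = h"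
        using p assms by (auto simp: b_def fun_eq_iff K_def PiE_def extensional_def)
      ultimately show ?thesis by (simp add: a_def p)
    qed
  qed
  then have "card ?L = card ?R" by (rule bij_betw_same_card)
  also have "card ?R = (\<Sum>s<t. card (G s \<times> K s))"
    by (intro card_UN_disjoint) (auto simp: finG, auto simp: G_def)
  also have "\<dots> = (\<Sum>s<t. (s + k - 1 choose (k - 1)) * (s + (card F - k) - 1 choose (card F - k - 1)))"
  proof (intro sum.cong refl)
    fix s assume "s \<in> {..<t}"
    then have "s \<le> t" by simp
    have "H \<noteq> {}" "F - H \<noteq> {}" using assms cFH by auto
    have "card (G s) = (s + k - 1 choose (k - 1))"
      unfolding G_def using card_compositions[of H s t] fin \<open>s \<le> t\<close> \<open>H \<noteq> {}\<close> \<open>card H = k\<close> by simp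
    moreover have "card (K s) = (s + (card F - k) - 1 choose (card F - k - 1))"
      unfolding K_def using card_compositions[of "F - H" s t] fin \<open>s \<le> t\<close> \<open>F - H \<noteq> {}\<close> cFH by simp
    ultimately show "card (G s \<times> K s) = (s + k - 1 choose (k - 1)) * (s + (card F - k) - 1 choose (card F - k - 1))"
      by (simp add: card_cartesian_product)
  qed
  finally have "real (card ?L) = real (\<Sum>s<t. (s + k - 1 choose (k - 1)) * (s + (card F - k) - 1 choose (card F - k - 1)))"
    by (rule arg_cong)
  then show ?thesis
    using assms by (subst poly_excess_poly) auto
qed

text \<open>No point violates two of the inequalities: f(H) + f(H') = f(H \<union> H') + f(H
  \<inter> H') is at most kt + (k-2)t = 2(k-1)t. So the excess counts simply add up.\<close>

lemma card_sparse_paving_points: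
  fixes F :: "'a set"
  assumes F: "finite F" and k: "2 \<le> k" "k < card F"
    and sub: "\<And>H. H \<in> \<H> \<Longrightarrow> H \<subseteq> F" and card: "\<And>H. H \<in> \<H> \<Longrightarrow> card H = k"
    and inter: "\<And>H H'. \<lbrakk>H \<in> \<H>; H' \<in> \<H>; H \<noteq> H'\<rbrakk> \<Longrightarrow> card (H \<inter> H') + 2 \<le> k"
  shows "real (card {f \<in> F \<rightarrow>\<^sub>E {..t}. sum f F = k * t \<and> (\<forall>H\<in>\<H>. sum f H \<le> (k - 1) * t)}) =
    poly (hypersimplex_poly k (card F) - smult (real (card \<H>)) (excess_poly k (card F - k))) (real t)"
proof -
  define A where "A = {f \<in> F \<rightarrow>\<^sub>E {..t}. sum f F = k * t}"
  define X where "X H = {f \<in> F \<rightarrow>\<^sub>E {..t}. sum f F = k * t \<and> (k - 1) * t < sum f H}" for H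
  have finA: "finite A" unfolding A_def using F by (auto intro!: finite_PiE finite_Collect_conjI)
  have finH: "finite \<H>" using sub F by (meson Pow_iff finite_Pow_iff finite_subset subsetI)
  have XA: "X H \<subseteq> A" for H by (auto simp: X_def A_def)
  have disj: "X H \<inter> X H' = {}" if H: "H \<in> \<H>" "H' \<in> \<H>" "H \<noteq> H'" for H H'
  proof (rule ccontr)
    assume "\<not> ?thesis"
    then obtain f where f: "f \<in> F \<rightarrow>\<^sub>E {..t}" "sum f F = k * t" "(k - 1) * t < sum f H" "(k - 1) * t < sum f H'"
      by (auto simp: X_def)
    have fin: "finite H" "finite H'" using H sub F finite_subset by blast+
    have "sum f (H \<union> H') \<le> k * t"
      unfolding f(2)[symmetric] using H sub F by (intro sum_mono2) auto
    moreover have "sum f (H \<inter> H') \<le> card (H \<inter> H') * t"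
      using sum_bounded_above[of "H \<inter> H'" f t] f(1) H sub by fastforce
    moreover have "card (H \<inter> H') * t \<le> (k - 2) * t"
      using inter[OF H] by (intro mult_le_mono1) auto
    moreover have "(k - 2) * t + k * t = 2 * ((k - 1) * t)"
      using k by (simp add: diff_mult_distrib)
    ultimately show False using f(3,4) sum.union_inter[OF fin, of f] by linarith
  qed
  have "{f \<in> F \<rightarrow>\<^sub>E {..t}. sum f F = k * t \<and> (\<forall>H\<in>\<H>. sum f H \<le> (k - 1) * t)} = A - (\<Union>H\<in>\<H>. X H)"
    by (auto simp: A_def X_def not_less)
  moreover have "card (A - (\<Union>H\<in>\<H>. X H)) = card A - card (\<Union>H\<in>\<H>. X H)"
    using XA finA by (intro card_Diff_subset finite_subset[of "\<Union>H\<in>\<H>. X H" A]) auto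
  moreover have "card (\<Union>H\<in>\<H>. X H) \<le> card A" using XA finA by (intro card_mono) auto
  moreover have "card (\<Union>H\<in>\<H>. X H) = (\<Sum>H\<in>\<H>. card (X H))"
    using finH finite_subset[OF XA finA] disj by (intro card_UN_disjoint) auto
  ultimately have "real (card {f \<in> F \<rightarrow>\<^sub>E {..t}. sum f F = k * t \<and> (\<forall>H\<in>\<H>. sum f H \<le> (k - 1) * t)}) =
      real (card A) - (\<Sum>H\<in>\<H>. real (card (X H)))"
    by (simp add: of_nat_diff)
  also have "(\<Sum>H\<in>\<H>. real (card (X H))) = (\<Sum>H\<in>\<H>. poly (excess_poly k (card F - k)) (real t))"
    unfolding X_def using F k sub card by (intro sum.cong refl card_excess_points) auto
  also have "real (card A) = poly (hypersimplex_poly k (card F)) t"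
    unfolding A_def using F k by (intro card_hypersimplex_points) auto
  finally show ?thesis by simp
qed

section \<open>Cubic coefficients\<close>

text \<open>The binomial coefficient (N + x choose N). With constant term 1 in every factor, its
  coefficients are the elementary symmetric functions of 1, 1/2, ..., 1/N.\<close>

definition rising_poly :: "nat \<Rightarrow> real poly" where
  "rising_poly N = (\<Prod>i<N. [:1, 1 / real (Suc i):])"

definition falling_poly :: "nat \<Rightarrow> real poly" where
  "falling_poly j = (\<Prod>i<j. [:- real i, 1:])"

lemma coeff_binomial_poly_scale: "coeff (binomial_poly a c m) i = a ^ i * coeff (binomial_poly 1 c m) i"
proof -
  have "binomial_poly a c m = pcompose (binomial_poly 1 c m) [:0, a:]"
    by (simp add: binomial_poly_def pcompose_smult pcompose_prod pcompose_pCons)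
  then show ?thesis by (simp add: coeff_pcompose_linear)
qed

text \<open>The factors are N + x, ..., 1 + x followed by x, x - 1, ..., x - j + 1. This confines
  the nonpositive constant terms to \<open>j\<close> factors, and \<open>j\<close> stays below 5 in
  the application.\<close>

lemma binomial_poly_eq:
  "binomial_poly 1 (real N) (N + j) = smult (fact N / fact (N + j)) (rising_poly N * falling_poly j)"
proof -
  have "(\<Prod>i<N + j. [:real N - real i, 1:]) =
      (\<Prod>i<N. [:real N - real i, 1:]) * (\<Prod>i<j. [:real N - real (N + i), 1:])"
  proof (induction j)
    case (Suc j)
    show ?case unfolding add_Suc_right prod.lessThan_Suc Suc.IH mult.assoc ..
  qed simp
  also have "(\<Prod>i<N. [:real N - real i, 1:]) = (\<Prod>i<N. [:real (Suc i), 1:])"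
  proof -
    have "(\<Prod>i<N. [:real (Suc i), 1:]) = (\<Prod>i<N. [:real (Suc (N - Suc i)), 1:])"
      by (rule prod.nat_diff_reindex[symmetric])
    also have "\<dots> = (\<Prod>i<N. [:real N - real i, 1:])"
      by (intro prod.cong refl) (auto simp: of_nat_diff)
    finally show ?thesis ..
  qed
  also have "(\<Prod>i<N. [:real (Suc i), 1:]) = smult (fact N) (rising_poly N)"
  proof (induction N)
    case (Suc N)
    have "[:real (Suc N), 1:] = smult (real (Suc N)) [:1, 1 / real (Suc N):]" by simp
    then have "(\<Prod>i<Suc N. [:real (Suc i), 1:]) =
        smult (fact N) (rising_poly N) * smult (real (Suc N)) [:1, 1 / real (Suc N):]"
      unfolding prod.lessThan_Suc Suc.IH by (rule arg_cong)
    also have "\<dots> = smult (real (Suc N) * fact N) (rising_poly N * [:1, 1 / real (Suc N):])"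
      by (simp only: mult_smult_left mult_smult_right smult_smult mult.commute)
    finally show ?case by (simp only: rising_poly_def prod.lessThan_Suc fact_Suc)
  qed (simp add: rising_poly_def)
  finally show ?thesis by (simp add: binomial_poly_def falling_poly_def)
qed

text \<open>Generalised harmonic numbers, that is, the power sums of 1, 1/2, ..., 1/N.\<close>

definition harm_pow :: "nat \<Rightarrow> nat \<Rightarrow> real" where
  "harm_pow p N = (\<Sum>i<N. 1 / real (Suc i) ^ p)"

lemma coeff_mult_linear:
  fixes p :: "real poly"
  shows "coeff (p * [:1, c:]) 0 = coeff p 0" "coeff (p * [:1, c:]) (Suc i) = coeff p (Suc i) + c * coeff p i"
  by (simp_all add: mult_pCons_right)

text \<open>Newton's identities: elementary symmetric functions in terms of power sums. A further
  factor 1 + cx adjoins the variable \<open>c\<close>.\<close>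

lemma coeff_rising_poly:
  "coeff (rising_poly N) 0 = 1"
  "coeff (rising_poly N) 1 = harm N"
  "coeff (rising_poly N) 2 = (harm N ^ 2 - harm_pow 2 N) / 2"
  "coeff (rising_poly N) 3 = (harm N ^ 3 - 3 * harm N * harm_pow 2 N + 2 * harm_pow 3 N) / 6"
proof -
  have "coeff (rising_poly N) 0 = 1 \<and> coeff (rising_poly N) 1 = harm N \<and>
    coeff (rising_poly N) 2 = (harm N ^ 2 - harm_pow 2 N) / 2 \<and>
    coeff (rising_poly N) 3 = (harm N ^ 3 - 3 * harm N * harm_pow 2 N + 2 * harm_pow 3 N) / 6"
  proof (induction N)
    case 0
    show ?case by (simp add: rising_poly_def harm_pow_def harm_def)
  next
    case (Suc N)
    define c where "c = 1 / real (Suc N)"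
    have r: "rising_poly (Suc N) = rising_poly N * [:1, c:]" by (simp add: rising_poly_def c_def)
    have h: "harm (Suc N) = harm N + c" by (simp add: harm_Suc c_def inverse_eq_divide)
    have hp: "harm_pow p (Suc N) = harm_pow p N + c ^ p" for p
      by (simp add: harm_pow_def c_def power_divide)
    have e: "coeff (rising_poly (Suc N)) 1 = coeff (rising_poly N) 1 + c * coeff (rising_poly N) 0"
      "coeff (rising_poly (Suc N)) 2 = coeff (rising_poly N) 2 + c * coeff (rising_poly N) 1"
      "coeff (rising_poly (Suc N)) 3 = coeff (rising_poly N) 3 + c * coeff (rising_poly N) 2"
      using coeff_mult_linear(2)[of "rising_poly N" c]
      by (simp_all only: r One_nat_def numeral_2_eq_2 numeral_3_eq_3)
    have e0: "coeff (rising_poly (Suc N)) 0 = coeff (rising_poly N) 0"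
      unfolding r by (rule coeff_mult_linear)
    from Suc.IH have IH: "coeff (rising_poly N) 0 = 1" "coeff (rising_poly N) 1 = harm N"
      "coeff (rising_poly N) 2 = (harm N ^ 2 - harm_pow 2 N) / 2"
      "coeff (rising_poly N) 3 = (harm N ^ 3 - 3 * harm N * harm_pow 2 N + 2 * harm_pow 3 N) / 6"
      by blast+
    show ?case unfolding e e0 h hp IH
      by (simp add: field_simps power2_eq_square power3_eq_cube)
  qed
  then show "coeff (rising_poly N) 0 = 1"
  "coeff (rising_poly N) 1 = harm N"
  "coeff (rising_poly N) 2 = (harm N ^ 2 - harm_pow 2 N) / 2"
  "coeff (rising_poly N) 3 = (harm N ^ 3 - 3 * harm N * harm_pow 2 N + 2 * harm_pow 3 N) / 6" by blast+
qed

text \<open>These cases suffice because j < k <= 5. For j >= 1 the factor x in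
  \<open>falling_poly j\<close> lowers the degree, so the cubic coefficient of \<open>p\<close>
  enters only for j = 0.\<close>

lemma coeff_mult_falling_poly:
  "coeff (p * falling_poly 0) 3 = coeff p 3"
  "coeff (p * falling_poly 1) 3 = coeff p 2"
  "coeff (p * falling_poly 2) 3 = coeff p 1 - coeff p 2"
  "coeff (p * falling_poly 3) 3 = coeff p 0 - 3 * coeff p 1 + 2 * coeff p 2"
  "coeff (p * falling_poly 4) 3 = - 6 * coeff p 0 + 11 * coeff p 1 - 6 * coeff p 2"
proof -
  have f: "falling_poly 0 = [:1:]" "falling_poly 1 = [:0, 1:]" "falling_poly 2 = [:0, - 1, 1:]"
    "falling_poly 3 = [:0, 2, - 3, 1:]" "falling_poly 4 = [:0, - 6, 11, - 6, 1:]"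
    by (simp_all add: falling_poly_def eval_nat_numeral)
  show "coeff (p * falling_poly 0) 3 = coeff p 3"
  "coeff (p * falling_poly 1) 3 = coeff p 2"
  "coeff (p * falling_poly 2) 3 = coeff p 1 - coeff p 2"
  "coeff (p * falling_poly 3) 3 = coeff p 0 - 3 * coeff p 1 + 2 * coeff p 2"
  "coeff (p * falling_poly 4) 3 = - 6 * coeff p 0 + 11 * coeff p 1 - 6 * coeff p 2"
    unfolding f by (simp_all add: mult_pCons_right eval_nat_numeral)
qed

section \<open>Harmonic number estimates and the hypersimplex\<close>

text \<open>The stronger bound 2 - 1/N carries the induction, by 1/(N+1)^2 <= 1/N - 1/(N+1).\<close>

lemma harm_pow_2_le: "harm_pow 2 N \<le> 2"
proof -
  have "harm_pow 2 (Suc N) \<le> 2 - 1 / real (Suc N)" for N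
  proof (induction N)
    case (Suc N)
    have "1 / real (Suc (Suc N)) ^ 2 \<le> 1 / real (Suc N) - 1 / real (Suc (Suc N))"
    proof -
      have "1 / real (Suc (Suc N)) ^ 2 \<le> 1 / (real (Suc N) * real (Suc (Suc N)))"
        unfolding power2_eq_square by (intro divide_left_mono mult_right_mono) auto
      also have "\<dots> = 1 / real (Suc N) - 1 / real (Suc (Suc N))" by (simp add: field_simps)
      finally show ?thesis .
    qed
    then show ?case using Suc by (simp add: harm_pow_def)
  qed (simp add: harm_pow_def)
  from this[of "N - 1"] show ?thesis by (cases N) (auto simp: harm_pow_def intro: order_trans)
qed

text \<open>Seven is the least number of terms whose sum reaches 3/2.\<close>

lemma harm_pow_2_ge: "N \<ge> 7 \<Longrightarrow> harm_pow 2 N \<ge> 3 / 2"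
proof -
  assume "N \<ge> 7"
  then have "harm_pow 2 7 \<le> harm_pow 2 N" unfolding harm_pow_def by (intro sum_mono2) auto
  moreover have "harm_pow 2 7 \<ge> 3 / 2" by (simp add: harm_pow_def eval_nat_numeral)
  ultimately show ?thesis by simp
qed

lemma harm_pow_3_le: "harm_pow 3 N \<le> harm_pow 2 N"
  unfolding harm_pow_def by (intro sum_mono divide_left_mono power_increasing) auto

lemma coeff_2_rising_poly_ge:
  fixes x :: real
  assumes "x \<le> harm N" "0 \<le> x"
  shows "coeff (rising_poly N) 2 \<ge> (x ^ 2 - 2) / 2"
  using harm_pow_2_le[of N] power_mono[OF assms, of 2] by (simp add: coeff_rising_poly)

text \<open>With p2, p3 the power sums, p3 <= p2 and p2 >= 3/2 bound h^3 - 3 h p2 + 2 p3 by h^3 -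
  (3h - 2) 3/2. This cubic is increasing for h >= 2, so \<open>h\<close> may be replaced by its
  upper bound \<open>y\<close>.\<close>

lemma coeff_3_rising_poly_le:
  fixes y :: real
  assumes "harm N \<le> y" "2 \<le> (harm N :: real)" "7 \<le> N"
  shows "coeff (rising_poly N) 3 \<le> (y ^ 3 - (3 * y - 2) * (3 / 2)) / 6"
proof -
  define h :: real where "h = harm N"
  have h: "2 \<le> h" "h \<le> y" using assms by (simp_all add: h_def)
  have "(3 * h - 2) * (3 / 2) \<le> (3 * h - 2) * harm_pow 2 N"
    using h harm_pow_2_ge[OF assms(3)] by (intro mult_left_mono) auto
  then have "h ^ 3 - 3 * h * harm_pow 2 N + 2 * harm_pow 3 N \<le> h ^ 3 - (3 * h - 2) * (3 / 2)"
    using harm_pow_3_le[of N] by (simp add: algebra_simps)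
  then have "coeff (rising_poly N) 3 \<le> (h ^ 3 - (3 * h - 2) * (3 / 2)) / 6"
    unfolding coeff_rising_poly h_def[symmetric] by (rule divide_right_mono) simp
  also have "h ^ 3 - (3 * h - 2) * (3 / 2) \<le> y ^ 3 - (3 * y - 2) * (3 / 2)"
  proof -
    have "(9/2) * (y - h) \<le> (y ^ 2 + y * h + h ^ 2) * (y - h)"
    proof (intro mult_right_mono)
      have "2 * 2 \<le> y * y" "2 * 2 \<le> y * h" "2 * 2 \<le> h * h" using h by (intro mult_mono; simp)+
      then show "9/2 \<le> y ^ 2 + y * h + h ^ 2"
        by (simp add: power2_eq_square)
    qed (use h in simp)
    also have "\<dots> = y ^ 3 - h ^ 3" by (simp add: algebra_simps power2_eq_square power3_eq_cube)
    finally show ?thesis by (simp add: field_simps)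
  qed
  finally show ?thesis by simp
qed

text \<open>In the alternating sum only the term j = 0 is positive. The term j = 1 is kept, up to a
  factor n/(n-1) >= 1, because its saving is needed in the numerical cases; the terms j >= 2 are
  discarded.\<close>

lemma coeff_3_hypersimplex_poly_le:
  assumes k: "k \<in> {3, 4, 5}" and n: "k < n" and h: "4 \<le> (harm (n - k) :: real)"
  shows "coeff (hypersimplex_poly k n) 3 \<le>
    real k ^ 3 * coeff (rising_poly (n - 1)) 3 - (real k - 1) ^ 3 * coeff (rising_poly (n - 2)) 2"
proof -
  define T where "T j = (- 1) ^ j * real (n choose j) * (real k - real j) ^ 3 *
    (fact (n - 1 - j) / fact (n - 1) * coeff (rising_poly (n - 1 - j) * falling_poly j) 3)" for j
  have "coeff (binomial_poly (real k - real j) (real n - 1 - real j) (n - 1)) 3 = (real k - real j) ^ 3 *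
     (fact (n - 1 - j) / fact (n - 1) * coeff (rising_poly (n - 1 - j) * falling_poly j) 3)" if "j < k" for j
  proof -
    have e: "real n - 1 - real j = real (n - 1 - j)" "n - 1 - j + j = n - 1"
      using that n by (auto simp: of_nat_diff)
    show ?thesis
      using binomial_poly_eq[of "n - 1 - j" j]
      unfolding coeff_binomial_poly_scale[of "real k - real j"] e by simp
  qed
  then have eq: "coeff (hypersimplex_poly k n) 3 = (\<Sum>j<k. T j)"
    by (simp add: hypersimplex_poly_def coeff_sum T_def mult_ac)
  have hN: "4 \<le> (harm (n - 1 - j) :: real)" if "j < k" for j
  proof -
    have "harm (n - k) \<le> (harm (n - 1 - j) :: real)" using that n by (intro harm_mono) auto
    with h show ?thesis by simp
  qed
  \<comment> \<open>These are the signs for j = 2, 3, 4. All follow from e2 >= h^2/2 - 1 >= 2h - 1,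
    which holds for h >= 4.\<close>
  have r2: "coeff (rising_poly N) 2 \<ge> harm N" "1 + 2 * coeff (rising_poly N) 2 \<ge> 3 * harm N"
    "6 + 6 * coeff (rising_poly N) 2 \<ge> 11 * harm N" if "4 \<le> (harm N :: real)" for N
  proof -
    have "(harm N ^ 2 - 2) / 2 \<le> coeff (rising_poly N) 2"
      using that by (intro coeff_2_rising_poly_ge) auto
    moreover have "4 * harm N \<le> (harm N ^ 2 :: real)"
      using that unfolding power2_eq_square by (intro mult_right_mono) auto
    ultimately show "coeff (rising_poly N) 2 \<ge> harm N" "1 + 2 * coeff (rising_poly N) 2 \<ge> 3 * harm N"
    "6 + 6 * coeff (rising_poly N) 2 \<ge> 11 * harm N" using that by (auto simp: field_simps)
  qed
  have T0: "T 0 = real k ^ 3 * coeff (rising_poly (n - 1)) 3"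
    by (simp add: T_def coeff_mult_falling_poly)
  have T1: "T 1 \<le> - ((real k - 1) ^ 3 * coeff (rising_poly (n - 2)) 2)"
  proof -
    have "fact (n - 1) = real (n - 1) * fact (n - 2)"
      using n k fact_reduce[of "n - 1", where 'a = real] by (auto simp: numeral_2_eq_2)
    then have "T 1 = - ((real k - 1) ^ 3 * coeff (rising_poly (n - 2)) 2) * (real n / real (n - 1))"
      using coeff_mult_falling_poly(2)[of "rising_poly (n - 2)"] n by (simp add: T_def numeral_2_eq_2)
    moreover have "0 \<le> (real k - 1) ^ 3 * coeff (rising_poly (n - 2)) 2"
      using r2(1)[OF hN[of 1]] hN[of 1] k by (auto simp: numeral_2_eq_2)
    moreover have "1 \<le> real n / real (n - 1)" using n k by auto
    ultimately show ?thesis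
      using mult_left_mono[of 1 "real n / real (n - 1)" "(real k - 1) ^ 3 * coeff (rising_poly (n - 2)) 2"]
      by simp
  qed
  \<comment> \<open>The signs of \<open>falling_poly j\<close> beat the alternation as soon as the harmonic numbers exceed 11/3.\<close>
  have Tj: "T j \<le> 0" if "j \<in> {2, 3, 4}" "j < k" for j
  proof -
    have "(- 1) ^ j * coeff (rising_poly (n - 1 - j) * falling_poly j) 3 \<le> 0"
      using that(1) r2[OF hN[OF that(2)]]
      by (auto simp: coeff_mult_falling_poly coeff_rising_poly(1,2) simp del: One_nat_def)
    moreover have "0 \<le> real (n choose j) * (real k - real j) ^ 3 * (fact (n - 1 - j) / fact (n - 1))"
      using that by simp
    ultimately have "((- 1) ^ j * coeff (rising_poly (n - 1 - j) * falling_poly j) 3) *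
       (real (n choose j) * (real k - real j) ^ 3 * (fact (n - 1 - j) / fact (n - 1))) \<le> 0"
      by (rule mult_nonpos_nonneg)
    then show ?thesis by (simp add: T_def mult_ac)
  qed
  have "(\<Sum>j<k. T j) = T 0 + T 1 + sum T {2..<k}"
  proof -
    have "{..<k} = {0, 1} \<union> {2..<k}" using k by auto
    then show ?thesis by (simp add: sum.union_disjoint)
  qed
  moreover have "sum T {2..<k} \<le> 0"
    using k by (intro sum_nonpos Tj) auto
  ultimately show ?thesis using T0 T1 eq by simp
qed

section \<open>The cubic coefficient of the excess\<close>

text \<open>Since (x + j - 1 choose j) is x/j times \<open>rising_poly (j - 1)\<close>, the sum in
  \<open>excess_poly\<close> has linear coefficient \<open>weight_sum\<close> with c = 1 and
  quadratic coefficient \<open>weight_sum\<close> with c = \<open>harm\<close>.\<close>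

definition weight_sum :: "(nat \<Rightarrow> real) \<Rightarrow> nat \<Rightarrow> nat \<Rightarrow> real" where
  "weight_sum c k m = (\<Sum>j=1..<k. real (m - 1 + j choose j) / real j * c (j - 1))"

text \<open>Up to normalisation the polynomial is x times \<open>rising_poly (m - 1)\<close> times a
  sum \<open>S\<close> with constant term 1. Its cubic coefficient is therefore a quadratic
  coefficient of a product, from which the nonnegative contribution of
  \<open>rising_poly (m - 1)\<close> alone is dropped.\<close>

lemma coeff_3_excess_poly_ge:
  assumes "k \<ge> 1" "m \<ge> 1" "4 \<le> (harm (m - 1) :: real)"
  shows "coeff (excess_poly k m) 3 \<ge>
    (harm (m - 1) * weight_sum (\<lambda>_. 1) k m + weight_sum harm k m) / (real m * real (m + k - 1 choose (k - 1)))"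
proof -
  have bp: "binomial_poly 1 (real j - 1) j = smult (1 / real j) (rising_poly (j - 1) * [:0, 1:])" if "j \<ge> 1" for j
  proof -
    have e: "real j - 1 = real (j - 1)" "j - 1 + 1 = j" using that by auto
    have "fact j = real j * fact (j - 1)" using that by (simp add: fact_reduce)
    then show ?thesis
      using binomial_poly_eq[of "j - 1" 1] that unfolding e by (simp add: falling_poly_def)
  qed
  define S where "S = (\<Sum>j<k. smult (real (m - 1 + j choose j)) (binomial_poly 1 (real j - 1) j))"
  have S: "S = 1 + (\<Sum>j=1..<k. smult (real (m - 1 + j choose j) / real j) (rising_poly (j - 1) * [:0, 1:]))"
  proof -
    have "{..<k} = insert 0 {1..<k}" using assms by auto
    then have "S = 1 + (\<Sum>j=1..<k. smult (real (m - 1 + j choose j)) (binomial_poly 1 (real j - 1) j))"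
      by (simp add: S_def binomial_poly_def)
    then show ?thesis by (simp add: bp)
  qed
  have x: "coeff (p * [:0, 1:]) (Suc i) = coeff p i" for p :: "real poly" and i
    by (simp add: mult_pCons_right)
  have S0: "coeff S 0 = 1" by (simp add: S coeff_sum)
  have S1: "coeff S 1 = weight_sum (\<lambda>_. 1) k m"
    unfolding S One_nat_def by (simp add: coeff_sum weight_sum_def x coeff_rising_poly del: mult_pCons_right)
  have S2: "coeff S 2 = weight_sum harm k m"
    unfolding S numeral_2_eq_2
    by (simp add: coeff_sum weight_sum_def x coeff_rising_poly[unfolded One_nat_def] del: mult_pCons_right)
  have "coeff (excess_poly k m) 3 = coeff (rising_poly (m - 1) * S) 2 / (real m * real (m + k - 1 choose (k - 1)))"
    unfolding excess_poly_def S_def[symmetric] bp[OF assms(2)] numeral_3_eq_3 numeral_2_eq_2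
    by (simp add: mult_ac x)
  also have "coeff (rising_poly (m - 1) * S) 2 = 
    coeff S 2 + harm (m - 1) * coeff S 1 + coeff (rising_poly (m - 1)) 2"
    using S0 by (simp add: coeff_mult numeral_2_eq_2 coeff_rising_poly[unfolded One_nat_def numeral_2_eq_2])
  finally have eq: "coeff (excess_poly k m) 3 = (weight_sum harm k m + harm (m - 1) * weight_sum (\<lambda>_. 1) k m +
      coeff (rising_poly (m - 1)) 2) / (real m * real (m + k - 1 choose (k - 1)))"
    unfolding S1 S2 .
  have "coeff (rising_poly (m - 1)) 2 \<ge> 0"
  proof -
    have "2 \<le> (harm (m - 1) ^ 2 :: real)" using power_mono[OF assms(3), of 2] by simp
    then show ?thesis using coeff_2_rising_poly_ge[of "harm (m - 1)" "m - 1"] assms(3) by simp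
  qed
  then show ?thesis unfolding eq by (intro divide_right_mono) auto
qed

text \<open>Reduces negativity to one inequality between numbers, given bounds \<open>x\<close> and
  \<open>y\<close> for two harmonic numbers. The point is (n choose k) / n = (n-1 choose k-1) / k
  for n = m + k: the large binomial coefficient cancels against the one in
  \<open>excess_poly\<close>, leaving the denominator km.\<close>

lemma coeff_3_negative:
  fixes x y l :: real
  assumes k: "k \<in> {3, 4, 5}" and m: "8 \<le> m" and x: "4 \<le> x" "x \<le> harm (m - 1)"
    and y: "harm (m + k - 1) \<le> y" and l: "real (m + k choose k) / real (m + k) \<le> l"
    and less: "real k ^ 3 * ((y ^ 3 - (3 * y - 2) * (3 / 2)) / 6) - (real k - 1) ^ 3 * ((x ^ 2 - 2) / 2) <
      (x * weight_sum (\<lambda>_. 1) k m + weight_sum harm k m) / (real k * real m)"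
  shows "coeff (hypersimplex_poly k (m + k) - smult l (excess_poly k m)) 3 < 0"
proof -
  have mono: "x \<le> harm N" if "m - 1 \<le> N" for N
    using x(2) harm_mono[OF that, where 'a = real] by linarith
  have "coeff (rising_poly (m + k - 1)) 3 \<le> (y ^ 3 - (3 * y - 2) * (3 / 2)) / 6"
  proof (rule coeff_3_rising_poly_le)
    have "x \<le> harm (m + k - 1)" using k by (intro mono) auto
    then show "2 \<le> (harm (m + k - 1) :: real)" using x by linarith
  qed (use y m k in auto)
  moreover have "(x ^ 2 - 2) / 2 \<le> coeff (rising_poly (m + k - 2)) 2"
    using mono[of "m + k - 2"] x k by (intro coeff_2_rising_poly_ge) auto
  ultimately have "real k ^ 3 * coeff (rising_poly (m + k - 1)) 3 - (real k - 1) ^ 3 * coeff (rising_poly (m + k - 2)) 2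
    \<le> real k ^ 3 * ((y ^ 3 - (3 * y - 2) * (3 / 2)) / 6) - (real k - 1) ^ 3 * ((x ^ 2 - 2) / 2)"
    using k by (intro diff_mono mult_left_mono) auto
  moreover have "coeff (hypersimplex_poly k (m + k)) 3 \<le>
      real k ^ 3 * coeff (rising_poly (m + k - 1)) 3 - (real k - 1) ^ 3 * coeff (rising_poly (m + k - 2)) 2"
    using k m mono[of m] x by (intro coeff_3_hypersimplex_poly_le) auto
  moreover have "(x * weight_sum (\<lambda>_. 1) k m + weight_sum harm k m) / (real k * real m) \<le>
      l * coeff (excess_poly k m) 3"
  proof -
    have w: "weight_sum (\<lambda>_. 1) k m \<ge> 0" "weight_sum harm k m \<ge> 0"
      unfolding weight_sum_def by (intro sum_nonneg mult_nonneg_nonneg divide_nonneg_nonneg harm_nonneg; simp)+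
    define W where "W = x * weight_sum (\<lambda>_. 1) k m + weight_sum harm k m"
    define b where "b = real (m + k - 1 choose (k - 1))"
    have b: "b > 0" using m k by (auto simp: b_def)
    have "real k * real (m + k choose k) = real (m + k) * b"
    proof -
      have "k * (m + k choose k) = (m + k) * (m + k - 1 choose (k - 1))"
        using k by (intro times_binomial_minus1_eq) auto
      from arg_cong[OF this, of real] show ?thesis unfolding b_def by (simp only: of_nat_mult)
    qed
    then have e: "real (m + k choose k) / real (m + k) = b / real k"
      using k m by (auto simp: field_simps)
    have "W / (real m * b) \<le> (harm (m - 1) * weight_sum (\<lambda>_. 1) k m + weight_sum harm k m) / (real m * b)"
      unfolding W_def using x(2) w b by (intro divide_right_mono add_mono mult_right_mono) auto
    also have "\<dots> \<le> coeff (excess_poly k m) 3"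
      unfolding b_def using k m x by (intro coeff_3_excess_poly_ge) auto
    finally have W: "W / (real m * b) \<le> coeff (excess_poly k m) 3" .
    have "0 \<le> b / real k" using b by simp
    then have "0 \<le> l" using l[unfolded e] by linarith
    with W have "b / real k * (W / (real m * b)) \<le> l * coeff (excess_poly k m) 3"
      using l[unfolded e] b w x by (intro mult_mono) (auto simp: W_def)
    then show ?thesis using b by (simp add: W_def)
  qed
  ultimately show ?thesis using less by simp
qed

section \<open>The three numerical cases\<close>

lemma choose_reals:
  "real (N choose 2) = real N * (real N - 1) / 2"
  "real (N choose 3) = real N * (real N - 1) * (real N - 2) / 6"
  "real (N choose 4) = real N * (real N - 1) * (real N - 2) * (real N - 3) / 24"
  "real (N choose 5) = real N * (real N - 1) * (real N - 2) * (real N - 3) * (real N - 4) / 120"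
  by (simp_all add: binomial_gbinomial gbinomial_prod_rev eval_nat_numeral)

text \<open>The denominators 4, 18, 96 are j * j! for j = 2, 3, 4.\<close>

lemma weight_sums:
  "weight_sum c 3 m = real m * c 0 + real (m + 1) * real m / 4 * c 1" (is ?t3)
  "weight_sum c 4 m = real m * c 0 + real (m + 1) * real m / 4 * c 1 +
    real (m + 2) * real (m + 1) * real m / 18 * c 2" (is ?t4)
  "weight_sum c 5 m = real m * c 0 + real (m + 1) * real m / 4 * c 1 +
    real (m + 2) * real (m + 1) * real m / 18 * c 2 +
    real (m + 3) * real (m + 2) * real (m + 1) * real m / 96 * c 3" (is ?t5)
  if "m \<ge> 1" for m :: nat
proof -
  have s: "{1..<3} = {1, 2 :: nat}" "{1..<4} = {1, 2, 3 :: nat}" "{1..<5} = {1, 2, 3, 4 :: nat}" by auto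
  have "m - 1 + 1 = m" "m - 1 + 2 = m + 1" "m - 1 + 3 = m + 2" "m - 1 + 4 = m + 3" using that by auto
  then show ?t3 ?t4 ?t5
    unfolding weight_sum_def s by (simp_all add: choose_reals)
qed

lemma harm_small: "harm 1 = (1 :: real)" "harm 2 = (3 / 2 :: real)" "harm 3 = (11 / 6 :: real)"
  by (simp_all add: harm_expand)

lemma coeff_3_negative_3_3586:
  assumes "real (3589 choose 3) / 3589 \<le> l"
  shows "coeff (hypersimplex_poly 3 3589 - smult l (excess_poly 3 3586)) 3 < 0"
proof -
  have "(8 :: real) \<le> harm 3585"
  proof -
    \<comment> \<open>The sum is too long to evaluate; a logarithm bounds it below, and 2.72^8 is
      less than 2997.\<close>
    have "exp (8 :: real) = exp 1 ^ 8" by (simp flip: exp_of_nat_mult)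
    also have "\<dots> \<le> (272 / 100) ^ 8" using e_less_272 by (intro power_mono) auto
    also have "\<dots> \<le> real 3585 + 1" by (simp add: power_divide)
    finally have "8 \<le> ln (real 3585 + 1)" by (subst ln_ge_iff) auto
    then show ?thesis using harm_ge_ln[of 3585] by linarith
  qed
  moreover have "harm 3588 \<le> (88 / 10 :: real)"
  proof -
    \<comment> \<open>The number 57 is the least N with 64 N >= 3588, so the logarithms differ by at
      most 6 ln 2 and only a short harmonic sum is evaluated. The final inequality is roughly 2654 <
      2693.\<close>
    have "harm 3588 - ln (real 3588) \<le> harm 57 - ln (real 57)"
      by (rule euler_mascheroni_sequence_decreasing) auto
    moreover have "ln (real 3588) - ln (real 57) \<le> 6 * ln 2"
    proof -
      have "ln (real 3588) - ln (real 57) = ln (real 3588 / real 57)" by (subst ln_div) auto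
      also have "\<dots> \<le> ln (2 ^ 6)" by (subst ln_le_cancel_iff) auto
      also have "\<dots> = 6 * ln 2" by (subst ln_realpow) auto
      finally show ?thesis .
    qed
    moreover have "harm 57 \<le> (463 / 100 :: real)" by (simp add: harm_expand)
    ultimately show ?thesis using ln2_le_25_over_36 by linarith
  qed
  ultimately show ?thesis
    using coeff_3_negative[of 3 3586 8 "88 / 10" l] assms
    by (simp add: weight_sums harm_small[unfolded One_nat_def] harm_expand(1) power_divide del: binomial_Suc_Suc)
qed

text \<open>Both harmonic sums are short enough for exact evaluation, which permits close decimal
  bounds; the final inequality is roughly 963 < 995.\<close>

lemma coeff_3_negative_4_100:
  assumes "real (104 choose 4) / 104 \<le> l"
  shows "coeff (hypersimplex_poly 4 104 - smult l (excess_poly 4 100)) 3 < 0"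
proof -
  have "(517 / 100 :: real) \<le> harm 99" "harm 103 \<le> (5218 / 1000 :: real)"
    by (simp_all add: harm_expand)
  then show ?thesis
    using coeff_3_negative[of 4 100 "517 / 100" "5218 / 1000" l] assms
    by (simp add: weight_sums harm_small[unfolded One_nat_def] harm_expand(1) power_divide del: binomial_Suc_Suc)
qed

lemma coeff_3_negative_5_52:
  assumes "real (57 choose 5) / 57 \<le> l"
  shows "coeff (hypersimplex_poly 5 57 - smult l (excess_poly 5 52)) 3 < 0"
proof -
  have "(45 / 10 :: real) \<le> harm 51" "harm 56 \<le> (462 / 100 :: real)"
    by (simp_all add: harm_expand)
  then show ?thesis
    using coeff_3_negative[of 5 52 "45 / 10" "462 / 100" l] assms
    by (simp add: weight_sums harm_small[unfolded One_nat_def] harm_expand(1) power_divide del: binomial_Suc_Suc)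
qed

section \<open>Degrees\<close>

lemma degree_binomial_poly_le: "degree (binomial_poly a c m) \<le> m"
  and coeff_binomial_poly_top: "coeff (binomial_poly a c m) m = a ^ m / fact m"
proof -
  have "degree (\<Prod>i<m. [:c - real i, a:]) \<le> m \<and> coeff (\<Prod>i<m. [:c - real i, a:]) m = a ^ m"
  proof (induction m)
    case (Suc m)
    let ?p = "\<Prod>i<m. [:c - real i, a:]"
    have "degree (?p * [:c - real m, a:]) \<le> Suc m"
      using degree_mult_le[of ?p "[:c - real m, a:]"] Suc
      by (simp add: degree_pCons_eq_if split: if_splits)
    moreover have "coeff ?p (Suc m) = 0" using Suc by (simp add: coeff_eq_0)
    then have "coeff (?p * [:c - real m, a:]) (Suc m) = a * coeff ?p m"
      by (simp add: mult_pCons_right)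
    ultimately show ?case using Suc by simp
  qed simp
  then show "degree (binomial_poly a c m) \<le> m" "coeff (binomial_poly a c m) m = a ^ m / fact m"
    by (simp_all add: binomial_poly_def)
qed

lemma coeff_mult_top:
  fixes p q :: "real poly"
  assumes "degree p \<le> a" "degree q \<le> b"
  shows "coeff (p * q) (a + b) = coeff p a * coeff q b"
proof -
  have "coeff (p * q) (a + b) = (\<Sum>i\<le>a + b. coeff p i * coeff q (a + b - i))" by (rule coeff_mult)
  also have "\<dots> = (\<Sum>i\<in>{a}. coeff p i * coeff q (a + b - i))"
  proof (intro sum.mono_neutral_right ballI)
    fix i assume "i \<in> {..a + b} - {a}"
    then consider "a < i" | "b < a + b - i" by fastforce
    then show "coeff p i * coeff q (a + b - i) = 0"
      by cases (use assms in \<open>simp_all add: coeff_eq_0\<close>)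
  qed auto
  finally show ?thesis by simp
qed

lemma degree_hypersimplex_poly_le: "degree (hypersimplex_poly k n) \<le> n - 1"
  unfolding hypersimplex_poly_def
  by (intro degree_sum_le order_trans[OF degree_smult_le degree_binomial_poly_le]) simp

text \<open>The numerator is an Eulerian number, the normalised volume of the hypersimplex.\<close>

lemma coeff_hypersimplex_poly_top:
  "coeff (hypersimplex_poly k n) (n - 1) =
    (\<Sum>j<k. (- 1) ^ j * real (n choose j) * (real k - real j) ^ (n - 1)) / fact (n - 1)"
  by (simp add: hypersimplex_poly_def coeff_sum coeff_binomial_poly_top sum_divide_distrib)

text \<open>Only the last summand j = k - 1 reaches the top degree, and the denominators combine to
  (m+k-1)!.\<close>

lemma degree_excess_poly_le: "degree (excess_poly k m) \<le> m + (k - 1)"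
  and coeff_excess_poly_top:
    "\<lbrakk>1 \<le> k; 1 \<le> m\<rbrakk> \<Longrightarrow> coeff (excess_poly k m) (m + (k - 1)) = real (m + k - 2 choose (k - 1)) / fact (m + k - 1)"
proof -
  define S where "S = (\<Sum>j<k. smult (real (m - 1 + j choose j)) (binomial_poly 1 (real j - 1) j))"
  have degS: "degree S \<le> k - 1"
    unfolding S_def
  proof (rule degree_sum_le)
    fix j assume "j \<in> {..<k}"
    then have "j \<le> k - 1" by auto
    then show "degree (smult (real (m - 1 + j choose j)) (binomial_poly 1 (real j - 1) j)) \<le> k - 1"
      by (rule order_trans[OF order_trans[OF degree_smult_le degree_binomial_poly_le]])
  qed simp
  have "degree (binomial_poly 1 (real m - 1) m * S) \<le> m + (k - 1)"
    using degree_mult_le[of "binomial_poly 1 (real m - 1) m" S] degS degree_binomial_poly_le[of 1 "real m - 1" m]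
    by linarith
  then show "degree (excess_poly k m) \<le> m + (k - 1)"
    unfolding excess_poly_def S_def[symmetric] by (rule order_trans[OF degree_smult_le])
  assume k: "1 \<le> k" "1 \<le> m"
  have "coeff S (k - 1) = (\<Sum>j\<in>{k - 1}. real (m - 1 + j choose j) * coeff (binomial_poly 1 (real j - 1) j) (k - 1))"
    unfolding S_def coeff_sum coeff_smult
  proof (intro sum.mono_neutral_right ballI)
    fix j assume "j \<in> {..<k} - {k - 1}"
    then have "j < k - 1" by auto
    then have "degree (binomial_poly 1 (real j - 1) j) < k - 1"
      using degree_binomial_poly_le le_less_trans by blast
    then show "real (m - 1 + j choose j) * coeff (binomial_poly 1 (real j - 1) j) (k - 1) = 0"
      by (simp add: coeff_eq_0)
  qed (use k in auto)
  then have S: "coeff S (k - 1) = real (m + k - 2 choose (k - 1)) / fact (k - 1)"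
    using k coeff_binomial_poly_top[of 1 "real (k - 1) - 1" "k - 1"] by (simp add: numeral_2_eq_2)
  have "m + k - 1 - (k - 1) = m" using k by simp
  then have "fact (k - 1) * fact m * (m + k - 1 choose (k - 1)) = fact (m + k - 1)"
    using binomial_fact_lemma[of "k - 1" "m + k - 1"] by simp
  from arg_cong[OF this, of real]
  have "fact (k - 1) * fact m * real (m + k - 1 choose (k - 1)) = fact (m + k - 1)"
    by (simp only: of_nat_mult of_nat_fact)
  then have f: "1 / real (m + k - 1 choose (k - 1)) * (1 / fact m * (c / fact (k - 1))) = c / fact (m + k - 1)" for c :: real
    using k by (auto simp: field_simps)
  show "coeff (excess_poly k m) (m + (k - 1)) = real (m + k - 2 choose (k - 1)) / fact (m + k - 1)"
    unfolding excess_poly_def S_def[symmetric] coeff_smult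
      coeff_mult_top[OF degree_binomial_poly_le degS] coeff_binomial_poly_top S power_one
    by (rule f)
qed

text \<open>The hypothesis \<open>pos\<close> compares the two leading coefficients multiplied by
  (m+k-1)!. The crude bound by all \<open>k\<close>-subsets is enough for \<open>l\<close>, as the
  Eulerian number is exponentially large.\<close>

lemma degree_sparse_paving_poly:
  assumes "1 \<le> k" "1 \<le> m" "l \<le> real (m + k choose k)"
    and pos: "real (m + k choose k) * real (m + k - 2 choose (k - 1)) <
      (\<Sum>j<k. (- 1) ^ j * real (m + k choose j) * (real k - real j) ^ (m + k - 1))"
  shows "degree (hypersimplex_poly k (m + k) - smult l (excess_poly k m)) = m + k - 1"
proof (rule antisym)
  have e: "m + (k - 1) = m + k - 1" using assms by simp
  show "degree (hypersimplex_poly k (m + k) - smult l (excess_poly k m)) \<le> m + k - 1"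
    using degree_excess_poly_le[of k m] unfolding e
    by (intro degree_diff_le degree_hypersimplex_poly_le) (rule order_trans[OF degree_smult_le])
  have "l * real (m + k - 2 choose (k - 1)) \<le> real (m + k choose k) * real (m + k - 2 choose (k - 1))"
    using assms by (intro mult_right_mono) auto
  with pos have "l * real (m + k - 2 choose (k - 1)) / fact (m + k - 1) <
      (\<Sum>j<k. (- 1) ^ j * real (m + k choose j) * (real k - real j) ^ (m + k - 1)) / fact (m + k - 1)"
    by (intro divide_strict_right_mono) auto
  then have "coeff (hypersimplex_poly k (m + k) - smult l (excess_poly k m)) (m + k - 1) \<noteq> 0"
    unfolding coeff_diff coeff_smult coeff_excess_poly_top[OF assms(1,2), unfolded e]
      coeff_hypersimplex_poly_top[of k "m + k"] times_divide_eq_right by linarith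
  then show "m + k - 1 \<le> degree (hypersimplex_poly k (m + k) - smult l (excess_poly k m))"
    by (rule le_degree)
qed

lemma degree_3_3586:
  assumes "l \<le> real (3589 choose 3)"
  shows "degree (hypersimplex_poly 3 3589 - smult l (excess_poly 3 3586)) = 3588"
proof -
  \<comment> \<open>The powers with exponent 3588 are kept symbolic: after splitting off exponent
    40, the relation 1 <= P <= Q and the explicit factors decide the inequality.\<close>
  define P Q :: real where "P = 2 ^ 3548" and "Q = 3 ^ 3548"
  have P: "1 \<le> P" "P \<le> Q" unfolding P_def Q_def by (rule one_le_power power_mono; simp)+
  have p30: "(2 :: real) ^ 40 = 1099511627776" "(3 :: real) ^ 40 = 12157665459056928801" by simp_all
  have "3588 = 40 + (3548 :: nat)" by simp
  then have "(2 :: real) ^ 3588 = 2 ^ 40 * P" "(3 :: real) ^ 3588 = 3 ^ 40 * Q"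
    unfolding P_def Q_def by (simp_all only: power_add)
  then have p: "(2 :: real) ^ 3588 = 1099511627776 * P" "(3 :: real) ^ 3588 = 12157665459056928801 * Q"
    by (simp_all only: p30)
  have s: "{..<3} = {0, 1, 2 :: nat}" by auto
  have n: "3586 + 3 - 1 = (3588 :: nat)" "3586 + 3 - 2 = (3587 :: nat)" "3586 + 3 = (3589 :: nat)"
    "3 - 1 = (2 :: nat)" by simp_all
  have "real (3589 choose 3) * real (3587 choose 2) <
      (\<Sum>j<3. (- 1) ^ j * real (3589 choose j) * (real 3 - real j) ^ 3588)"
    unfolding s using P by (simp add: choose_reals p del: binomial_Suc_Suc power_numeral)
  then show ?thesis
    using degree_sparse_paving_poly[of 3 3586 l, unfolded n] assms by simp
qed

lemma degree_4_100:
  assumes "l \<le> real (104 choose 4)"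
  shows "degree (hypersimplex_poly 4 104 - smult l (excess_poly 4 100)) = 103"
proof -
  have "{..<4} = {0, 1, 2, 3 :: nat}" by auto
  then show ?thesis
    using degree_sparse_paving_poly[of 4 100 l] assms
    by (simp add: choose_reals del: binomial_Suc_Suc)
qed

lemma degree_5_52:
  assumes "l \<le> real (57 choose 5)"
  shows "degree (hypersimplex_poly 5 57 - smult l (excess_poly 5 52)) = 56"
proof -
  have "{..<5} = {0, 1, 2, 3, 4 :: nat}" by auto
  then show ?thesis
    using degree_sparse_paving_poly[of 5 52 l] assms
    by (simp add: choose_reals del: binomial_Suc_Suc)
qed

section \<open>Polytopes of sparse paving matroids\<close>

lemma incidence_vector_nth [simp]: "incidence_vector B $ i = of_bool (i \<in> B)"
  by (simp add: incidence_vector_def axis_def of_bool_def)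

text \<open>The elements of \<open>C\<close> are coloops and those outside \<open>C \<union> F\<close> are loops.\<close>

locale sparse_paving =
  fixes C F :: "'n::finite set" and k :: nat and \<H> :: "'n set set"
  assumes disjoint: "C \<inter> F = {}"
    and hyp_subset: "H \<in> \<H> \<Longrightarrow> H \<subseteq> F"
    and hyp_card: "H \<in> \<H> \<Longrightarrow> card H = k"
    and hyp_inter: "\<lbrakk>H \<in> \<H>; H' \<in> \<H>; H \<noteq> H'\<rbrakk> \<Longrightarrow> card (H \<inter> H') + 2 \<le> k"
    and rank_ge: "k \<ge> 2"
    and corank_ge: "k + 3 \<le> card F"
begin

definition bases :: "'n set set" where
  "bases = (\<lambda>B. C \<union> B) ` {B. B \<subseteq> F \<and> card B = k \<and> B \<notin> \<H>}"

lemma hyp_unique: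
  assumes "insert x A \<in> \<H>" "insert y A \<in> \<H>" "x \<notin> A" "y \<notin> A"
  shows "x = y"
proof (rule ccontr)
  assume "x \<noteq> y"
  then have "insert x A \<inter> insert y A = A" "insert x A \<noteq> insert y A" using assms by auto
  with hyp_inter[OF assms(1,2)] hyp_card[OF assms(1)] assms(3) show False by simp
qed

text \<open>Fix k - 2 elements. At least three candidates remain for the last one, and by
  \<open>hyp_unique\<close> each of \<open>i\<close>, \<open>j\<close> rules out at most one. The
  result provides two bases that differ by exchanging \<open>i\<close> and \<open>j\<close>, hence
  the direction e_i - e_j in the polytope.\<close>

lemma exists_common_part:
  assumes "i \<in> F" "j \<in> F" "i \<noteq> j"
  shows "\<exists>A. A \<subseteq> F - {i, j} \<and> card A = k - 1 \<and> insert i A \<notin> \<H> \<and> insert j A \<notin> \<H>"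
proof -
  have c: "card (F - {i, j}) \<ge> k + 1"
    using assms corank_ge by (simp add: card_Diff_subset)
  then obtain A where A: "A \<subseteq> F - {i, j}" "card A = k - 2"
    by (metis add_leD1 diff_le_self le_trans obtain_subset_with_card_n)
  have "card (F - {i, j} - A) \<ge> 3"
    using c A rank_ge by (simp add: card_Diff_subset)
  define X where "X l = {b. b \<notin> insert l A \<and> insert b (insert l A) \<in> \<H>}" for l
  have "\<forall>a\<in>X l. \<forall>b\<in>X l. a = b" for l
    by (auto simp: X_def intro: hyp_unique[of _ "insert l A"])
  then have "card (X l) \<le> 1" for l
    unfolding One_nat_def by (intro card_le_Suc0_iff_eq[THEN iffD2] finite)
  from add_mono[OF this this] have "card (X i \<union> X j) \<le> 2"
    unfolding one_add_one by (rule le_trans[OF card_Un_le])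
  then have "\<not> F - {i, j} - A \<subseteq> X i \<union> X j"
    using \<open>card (F - {i, j} - A) \<ge> 3\<close> card_mono[OF finite, of "F - {i, j} - A" "X i \<union> X j"]
    by (intro notI) simp
  then obtain b where b: "b \<in> F - {i, j} - A" "b \<notin> X i \<union> X j" by blast
  have "card (insert b A) = k - 1" using A b rank_ge by auto
  moreover have "insert i (insert b A) \<notin> \<H>" "insert j (insert b A) \<notin> \<H>"
    using b by (auto simp: insert_commute X_def)
  ultimately show ?thesis using A b by (intro exI[of _ "insert b A"]) auto
qed

lemma bases_nonempty: "bases \<noteq> {}"
proof -
  have "\<not> F \<subseteq> {}" "\<not> is_singleton F"
    using corank_ge by (auto simp: is_singleton_altdef)
  then obtain i j where "i \<in> F" "j \<in> F" "i \<noteq> j"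
    by (metis is_singletonI' subset_empty)
  from exists_common_part[OF this] obtain A where
    A: "A \<subseteq> F - {i, j}" "card A = k - 1" "insert i A \<notin> \<H>" by blast
  then have "insert i A \<subseteq> F \<and> card (insert i A) = k \<and> insert i A \<notin> \<H>"
    using \<open>i \<in> F\<close> rank_ge by (subst card_insert_disjoint) auto
  then show ?thesis unfolding bases_def by blast
qed

text \<open>If every exchange led into \<H>, \<open>hyp_unique\<close> would leave a single
  candidate \<open>y\<close>; the exchanged set would then be the second basis itself, which is not
  in \<H>.\<close>

lemma matroid_bases: "matroid UNIV bases"
proof
  show "bases \<noteq> {}" by (rule bases_nonempty)
next
  fix B1 B2 x assume "B1 \<in> bases" "B2 \<in> bases" and x: "x \<in> B1 - B2"
  then obtain A1 A2 where A: "B1 = C \<union> A1" "B2 = C \<union> A2" "A1 \<subseteq> F" "A2 \<subseteq> F"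
    "card A1 = k" "card A2 = k" "A1 \<notin> \<H>" "A2 \<notin> \<H>" by (auto simp: bases_def)
  have x': "x \<in> A1" "x \<notin> A2" "x \<notin> C" using x A by auto
  have ne: "A2 - A1 \<noteq> {}"
    using A x' by (metis Diff_eq_empty_iff card_subset_eq finite)
  have "\<exists>y\<in>A2 - A1. insert y (A1 - {x}) \<notin> \<H>"
  proof (rule ccontr)
    assume "\<not> ?thesis"
    then have H: "insert y (A1 - {x}) \<in> \<H>" if "y \<in> A2 - A1" for y using that by blast
    obtain y where y: "y \<in> A2 - A1" using ne by blast
    have "A2 - A1 = {y}" using y hyp_unique[OF H H] by blast
    then have "A2 \<subseteq> insert y (A1 - {x})" using x' by auto
    moreover have "card (insert y (A1 - {x})) = k"
      using y x' A card_Suc_Diff1[of A1 x] by simp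
    ultimately have "A2 = insert y (A1 - {x})" using A by (metis card_subset_eq finite)
    then show False using H[OF y] A by simp
  qed
  then obtain y where y: "y \<in> A2 - A1" "insert y (A1 - {x}) \<notin> \<H>" by blast
  have "card (insert y (A1 - {x})) = k"
    using y x' A card_Suc_Diff1[of A1 x] by simp
  moreover have "insert y (B1 - {x}) = C \<union> insert y (A1 - {x})" using A x' by auto
  ultimately have "insert y (B1 - {x}) \<in> bases" using y A unfolding bases_def by (intro image_eqI[of _ _ "insert y (A1 - {x})"]) auto
  moreover have "y \<in> B2 - B1" using y A disjoint by auto
  ultimately show "\<exists>y\<in>B2 - B1. insert y (B1 - {x}) \<in> bases" by blast
qed auto

lemma matroid_rank_bases: "matroid_rank bases = card C + k"
proof -
  interpret matroid UNIV bases by (rule matroid_bases)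
  obtain B where B: "B \<in> bases" using bases_nonempty by blast
  then have "card B = card C + k"
    using disjoint by (auto simp: bases_def intro!: card_Un_disjoint)
  then show ?thesis using matroid_rank_eq[OF B] by simp
qed

section \<open>Description of the polytope by inequalities\<close>

text \<open>Given by inequalities for every \<open>t\<close> at once, so that its lattice points can
  be read off; \<open>dilate_eq\<close> justifies the name.\<close>

definition dilate :: "nat \<Rightarrow> (real ^ 'n) set" where
  "dilate t = {x. (\<forall>i. 0 \<le> x $ i \<and> x $ i \<le> t) \<and> (\<forall>i\<in>C. x $ i = t) \<and> (\<forall>i. i \<notin> C \<union> F \<longrightarrow> x $ i = 0)
     \<and> sum (($) x) F = k * real t \<and> (\<forall>H\<in>\<H>. sum (($) x) H \<le> (real k - 1) * t)}"


lemma incidence_vector_in_dilate: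
  assumes "B \<in> bases" shows "incidence_vector B \<in> dilate 1"
proof -
  obtain A where A: "B = C \<union> A" "A \<subseteq> F" "card A = k" "A \<notin> \<H>" using assms by (auto simp: bases_def)
  have s: "sum (($) (incidence_vector B)) S = card (A \<inter> S)" if "S \<subseteq> F" for S
  proof -
    have "sum (($) (incidence_vector B)) S = (\<Sum>i\<in>S. if i \<in> A then 1 else (0::real))"
      using that A disjoint by (intro sum.cong) auto
    then show ?thesis by (simp add: sum.If_cases Int_commute)
  qed
  have "card (A \<inter> H) < k" if "H \<in> \<H>" for H
  proof (rule ccontr)
    assume "\<not> ?thesis"
    then have "A \<inter> H = A" "A \<inter> H = H"
      using A hyp_card[OF that] card_seteq[of A "A \<inter> H"] card_seteq[of H "A \<inter> H"] by auto
    then show False using A that by auto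
  qed
  then have "sum (($) (incidence_vector B)) H \<le> real k - 1" if "H \<in> \<H>" for H
    using that s[OF hyp_subset[OF that]] by (fastforce simp: of_nat_diff)
  then show ?thesis using A s[of F] disjoint by (auto simp: dilate_def Int_absorb2)
qed

lemma convex_dilate: "convex (dilate t)"
proof (rule convexI)
  fix x y :: "real ^ 'n" and u v :: real
  assume x: "x \<in> dilate t" and y: "y \<in> dilate t" and uv: "0 \<le> u" "0 \<le> v" "u + v = 1"
  have v: "v = 1 - u" using uv by simp
  have s: "sum (($) (u *\<^sub>R x + v *\<^sub>R y)) S = u * sum (($) x) S + v * sum (($) y) S" for S
    by (simp add: sum.distrib sum_distrib_left)
  have le: "u * a + v * b \<le> c" if "a \<le> c" "b \<le> c" for a b c
    using convex_bound_le[OF that uv] .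
  have eq: "u * a + v * b = c" if "a = c" "b = c" for a b c
    using that uv(3) by (simp add: distrib_right[symmetric])
  show "u *\<^sub>R x + v *\<^sub>R y \<in> dilate t"
    unfolding dilate_def mem_Collect_eq s
    using x y uv by (auto simp: dilate_def intro!: le eq)
qed

lemma compact_dilate: "compact (dilate t)"
proof -
  have "closed (dilate t)"
    unfolding dilate_def Ball_def
    by (intro closed_Collect_conj closed_Collect_all closed_Collect_le closed_Collect_eq
        closed_Collect_imp continuous_intros open_Collect_const)
  moreover have "dilate t \<subseteq> cbox 0 (\<chi> i. t)"
    by (auto simp: dilate_def mem_box_cart)
  ultimately show ?thesis
    by (metis bounded_cbox bounded_subset compact_eq_bounded_closed)
qed

text \<open>Two tight circuit-hyperplanes meet only where the point equals 1, so a point with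
  fractional coordinates can be moved within a single tight one.\<close>

lemma extreme_point_integral:
  assumes "v extreme_point_of (dilate 1)"
  shows "v $ i \<in> {0, 1}"
proof (rule ccontr)
  assume i: "v $ i \<notin> {0, 1}"
  have v: "v \<in> dilate 1" using assms by (simp add: extreme_point_of_def)
  have v01: "0 \<le> v $ l" "v $ l \<le> 1" for l using v by (auto simp: dilate_def)
  define R where "R = {l. v $ l \<notin> {0, 1}}"
  have RF: "R \<subseteq> F" using v by (force simp: R_def dilate_def)
  define T where "T = {H \<in> \<H>. sum (($) v) H = real k - 1}"
  \<comment> \<open>An integral sum cannot have exactly one fractional term. This is applied to a
    tight circuit-hyperplane, or to \<open>F\<close> when no tight one has a fractional
    coordinate.\<close>
  have partner: "\<exists>j\<in>A \<inter> R. j \<noteq> l" if A: "sum (($) v) A \<in> \<int>" "l \<in> A \<inter> R" for A l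
  proof (rule ccontr)
    assume "\<not> ?thesis"
    then have "v $ j \<in> \<int>" if "j \<in> A - {l}" for j using that by (auto simp: R_def)
    then have "sum (($) v) (A - {l}) \<in> \<int>" by (rule Ints_sum)
    moreover have "v $ l = sum (($) v) A - sum (($) v) (A - {l})"
      using A by (subst sum.remove[of A l]) auto
    ultimately have "v $ l \<in> \<int>" using A by auto
    then obtain z where z: "v $ l = of_int z" by (auto elim: Ints_cases)
    then have "0 \<le> z" "z \<le> 1" using v01[of l] by auto
    then have "z = 0 \<or> z = 1" by auto
    then show False using A z by (auto simp: R_def)
  qed
  \<comment> \<open>Otherwise v(H \<union> H') <= k and v(H \<inter> H') < k - 2, while the two add
    up to 2(k - 1).\<close>
  have tight: "H = H'" if H: "H \<in> T" "H' \<in> T" "l \<in> H \<inter> H'" "l \<in> R" for H H' l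
  proof (rule ccontr)
    assume "H \<noteq> H'"
    then have c: "real (card (H \<inter> H')) + 2 \<le> k" using hyp_inter[of H H'] H by (auto simp: T_def)
    have "sum (($) v) (H \<inter> H') < (\<Sum>i\<in>H \<inter> H'. 1)"
      using H v01 by (intro sum_strict_mono_ex1) (auto simp: R_def intro!: bexI[of _ l] order.not_eq_order_implies_strict)
    moreover have "sum (($) v) (H \<union> H') \<le> sum (($) v) F"
      using H hyp_subset v01 by (intro sum_mono2) (auto simp: T_def)
    moreover have "sum (($) v) F = k" using v by (simp add: dilate_def)
    moreover have "sum (($) v) (H \<union> H') + sum (($) v) (H \<inter> H') = 2 * (real k - 1)"
      using sum.union_inter[of H H' "($) v"] H by (simp add: T_def)
    ultimately show False using c by simp
  qed
  obtain i j where ij: "i \<in> R" "j \<in> R" "i \<noteq> j" "\<And>H. H \<in> T \<Longrightarrow> i \<in> H \<longleftrightarrow> j \<in> H"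
  proof (cases "\<exists>H\<in>T. H \<inter> R \<noteq> {}")
    case True
    then obtain H i where H: "H \<in> T" "i \<in> H \<inter> R" by blast
    have "sum (($) v) H \<in> \<int>" using H by (auto simp: T_def)
    then obtain j where j: "j \<in> H \<inter> R" "j \<noteq> i" using partner H by blast
    show ?thesis using that[of i j] H j tight by blast
  next
    case False
    have "sum (($) v) F \<in> \<int>" using v by (auto simp: dilate_def)
    moreover have "i \<in> F \<inter> R" using RF i by (auto simp: R_def)
    ultimately obtain j where "j \<in> F \<inter> R" "j \<noteq> i" using partner by blast
    then show ?thesis using that[of i j] False \<open>i \<in> F \<inter> R\<close> by blast
  qed
  \<comment> \<open>All slacks that a move along e_i - e_j can reduce. A move by \<open>d\<close>
    changes each by at most |d|; a tight circuit-hyperplane contains both \<open>i\<close> and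
    \<open>j\<close> or neither, so its sum is unchanged.\<close>
  define S where "S = {v $ i, 1 - v $ i, v $ j, 1 - v $ j} \<union>
     (\<lambda>H. real k - 1 - sum (($) v) H) ` (\<H> - T)"
  have finS: "finite S" "S \<noteq> {}" by (auto simp: S_def)
  define \<epsilon> where "\<epsilon> = Min S"
  have le: "\<epsilon> \<le> s" if "s \<in> S" for s using finS that by (simp add: \<epsilon>_def)
  have "0 < s" if "s \<in> S" for s
  proof -
    have "v $ i \<notin> {0, 1}" "v $ j \<notin> {0, 1}" using ij by (auto simp: R_def)
    moreover have "sum (($) v) H < real k - 1" if "H \<in> \<H> - T" for H
      using that v by (force simp: T_def dilate_def order.order_iff_strict)
    ultimately show ?thesis using that v01[of i] v01[of j] by (auto simp: S_def)
  qed
  then have pos: "\<epsilon> > 0" using finS by (simp add: \<epsilon>_def)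
  define w where "w d = v + d *\<^sub>R (axis i 1 - axis j 1)" for d :: real
  have w_nth: "w d $ l = v $ l + d * (of_bool (l = i) - of_bool (l = j))" for d l
    by (simp add: w_def axis_def)
  have w_sum: "sum (($) (w d)) A = sum (($) v) A + d * (of_bool (i \<in> A) - of_bool (j \<in> A))" for d A
  proof -
    have "(\<Sum>l\<in>A. of_bool (l = m)) = (of_bool (m \<in> A) :: real)" for m
      by (simp add: of_bool_def)
    then show ?thesis by (simp add: w_nth sum.distrib sum_distrib_left[symmetric] sum_subtractf)
  qed
  have w_in: "w d \<in> dilate 1" if d: "\<bar>d\<bar> \<le> \<epsilon>" for d
  proof -
    have "\<epsilon> \<le> v $ i" "\<epsilon> \<le> 1 - v $ i" "\<epsilon> \<le> v $ j" "\<epsilon> \<le> 1 - v $ j"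
      by (auto intro!: le simp: S_def)
    then have "0 \<le> w d $ l \<and> w d $ l \<le> 1" for l
      using d v01[of l] ij by (auto simp: w_nth of_bool_def)
    moreover have "w d $ l = v $ l" if "l \<notin> F" for l
      using that ij RF by (auto simp: w_nth)
    moreover have "sum (($) (w d)) F = k" using v ij RF by (auto simp: w_sum dilate_def)
    moreover have "sum (($) (w d)) H \<le> real k - 1" if "H \<in> \<H>" for H
    proof (cases "H \<in> T")
      case True
      then show ?thesis using ij(4)[OF True] by (simp add: w_sum T_def)
    next
      case False
      then have "\<epsilon> \<le> real k - 1 - sum (($) v) H" using that by (intro le) (auto simp: S_def)
      then show ?thesis using d by (auto simp: w_sum of_bool_def)
    qed
    moreover have "l \<notin> F" if "l \<in> C" for l using that disjoint by blast
    ultimately show ?thesis using v by (auto simp: dilate_def)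
  qed
  have "w \<epsilon> \<noteq> w (- \<epsilon>)"
  proof
    assume "w \<epsilon> = w (- \<epsilon>)"
    then have "w \<epsilon> $ i = w (- \<epsilon>) $ i" by simp
    then show False using ij pos by (simp add: w_nth)
  qed
  moreover have "midpoint (w \<epsilon>) (w (- \<epsilon>)) = v"
    by (simp add: midpoint_def w_def vec_eq_iff algebra_simps)
  ultimately have "v \<in> open_segment (w \<epsilon>) (w (- \<epsilon>))"
    by (metis midpoint_in_open_segment)
  then show False using assms w_in[of \<epsilon>] w_in[of "-\<epsilon>"] pos
    by (auto simp: extreme_point_of_def)
qed

text \<open>By Krein-Milman the inequality description is the hull of its extreme points. These are
  0/1 vectors, and the inequality for H excludes H itself as support in \<open>F\<close>.\<close>

lemma base_polytope_eq: "base_polytope bases = dilate 1"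
proof
  show "base_polytope bases \<subseteq> dilate 1"
    unfolding base_polytope_def
    using incidence_vector_in_dilate by (intro hull_minimal convex_dilate) blast
  have "v \<in> incidence_vector ` bases" if "v extreme_point_of (dilate 1)" for v
  proof -
    have v: "v \<in> dilate 1" using that by (simp add: extreme_point_of_def)
    define A where "A = {i \<in> F. v $ i = 1}"
    have v01: "v $ i \<in> {0, 1}" for i using extreme_point_integral[OF that] .
    have s: "sum (($) v) S = card (A \<inter> S)" if "S \<subseteq> F" for S
    proof -
      have "sum (($) v) S = (\<Sum>i\<in>S. if i \<in> A then 1 else (0::real))"
        using that v01 by (intro sum.cong) (auto simp: A_def)
      then show ?thesis by (simp add: sum.If_cases Int_commute)
    qed
    have A: "A \<subseteq> F" by (auto simp: A_def)
    have "real (card A) = k" using s[of F] v A by (simp add: dilate_def Int_absorb2)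
    moreover have "A \<notin> \<H>"
    proof
      assume "A \<in> \<H>"
      then have "real (card A) \<le> real k - 1" using s[OF A] v by (force simp: dilate_def)
      then show False using \<open>real (card A) = k\<close> by simp
    qed
    ultimately have "C \<union> A \<in> bases" using A by (auto simp: bases_def)
    moreover have "v = incidence_vector (C \<union> A)"
      using v v01 unfolding vec_eq_iff by (force simp: A_def dilate_def of_bool_def)
    ultimately show ?thesis by blast
  qed
  then have "convex hull {v. v extreme_point_of (dilate 1)} \<subseteq> base_polytope bases"
    unfolding base_polytope_def by (intro hull_mono) auto
  then show "dilate 1 \<subseteq> base_polytope bases"
    using Krein_Milman_Minkowski[OF compact_dilate convex_dilate] by blast
qed

lemma dilate_eq: "(\<lambda>x. real t *\<^sub>R x) ` base_polytope bases = dilate t"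
proof (cases "t = 0")
  \<comment> \<open>Scaling by 0 is not invertible; here both sides are {0}, as there is a
    basis.\<close>
  case True
  obtain x where "x \<in> base_polytope bases"
    using bases_nonempty hull_subset by (fastforce simp: base_polytope_def)
  moreover have "x = 0" if "x \<in> dilate 0" for x
    using that unfolding dilate_def vec_eq_iff by (simp add: order.antisym)
  then have "dilate 0 = {0}" by (auto simp: dilate_def)
  ultimately show ?thesis using True by auto
next
  case False
  then have t: "real t > 0" by simp
  have s: "sum (($) (c *\<^sub>R x)) S = c * sum (($) x) S" for c and x :: "real ^ 'n" and S
    by (simp add: sum_distrib_left)
  have sc: "real t *\<^sub>R x \<in> dilate t \<longleftrightarrow> x \<in> dilate 1" for x
    unfolding dilate_def mem_Collect_eq s using t False
    by (auto simp: mult.commute[of _ "real t"] zero_le_mult_iff)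
  show ?thesis unfolding base_polytope_eq
  proof (intro equalityI subsetI)
    fix y assume y: "y \<in> dilate t"
    have "real t *\<^sub>R (y /\<^sub>R real t) = y" using t by simp
    moreover from this have "y /\<^sub>R real t \<in> dilate 1" using sc[of "y /\<^sub>R real t"] y by simp
    ultimately show "y \<in> (*\<^sub>R) (real t) ` dilate 1" by (metis imageI)
  qed (use sc in blast)
qed

section \<open>Dimension\<close>

text \<open>The differences of vertices span the vectors supported on \<open>F\<close> with
  coordinate sum 0. One inclusion is this equation; the other takes e_i - e_f0 from the two bases of
  \<open>exists_common_part\<close>.\<close>

lemma aff_dim_base_polytope: "aff_dim (base_polytope bases) = int (card F) - 1"
proof -
  obtain f0 where f0: "f0 \<in> F" using corank_ge by fastforce
  obtain B0 where B0: "B0 \<in> bases" using bases_nonempty by blast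
  let ?a = "incidence_vector B0 :: real ^ 'n"
  define X where "X = (+) (- ?a) ` incidence_vector ` bases"
  define D where "D = (\<lambda>i. axis i 1 - axis f0 1 :: real ^ 'n) ` (F - {f0})"
  have "aff_dim (base_polytope bases) = int (dim X)"
    unfolding base_polytope_def aff_dim_convex_hull X_def
    using B0 by (intro aff_dim_eq_dim hull_inc) blast
  moreover have "span X = span D"
  proof (intro span_eq[THEN iffD2] conjI subsetI)
    fix x assume "x \<in> X"
    then obtain B where B: "B \<in> bases" "x = incidence_vector B - ?a" by (auto simp: X_def)
    have "?a \<in> dilate 1" "incidence_vector B \<in> dilate 1"
      using B B0 incidence_vector_in_dilate by blast+
    then have "sum (($) x) F = 0" and out: "l \<notin> F \<Longrightarrow> x $ l = 0" for l
      unfolding dilate_def B(2) vector_minus_component sum_subtractf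
      by simp_all (metis diff_self)
    then have x0: "x $ f0 = - sum (($) x) (F - {f0})"
      using sum.remove[OF _ f0, of "($) x"] by simp
    have "x $ l = (\<Sum>i\<in>F - {f0}. x $ i * (axis i 1 $ l - axis f0 1 $ l))" for l
    proof (cases "l = f0")
      case True
      have "(\<Sum>i\<in>F - {f0}. x $ i * (axis i 1 $ l - axis f0 1 $ l)) = (\<Sum>i\<in>F - {f0}. - x $ i)"
        using True by (intro sum.cong) (auto simp: axis_def)
      then show ?thesis using True x0 by (simp add: sum_negf)
    next
      case False
      then have "(\<Sum>i\<in>F - {f0}. x $ i * (axis i 1 $ l - axis f0 1 $ l)) =
          (\<Sum>i\<in>F - {f0}. if i = l then x $ i else 0)"
        by (intro sum.cong) (auto simp: axis_def)
      then show ?thesis using False out[of l] by simp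
    qed
    then have "x = (\<Sum>i\<in>F - {f0}. x $ i *\<^sub>R (axis i 1 - axis f0 1))"
      unfolding vec_eq_iff sum_component vector_scaleR_component vector_minus_component real_scaleR_def
      by blast
    also have "\<dots> \<in> span D" by (intro span_sum span_scale span_base) (simp add: D_def)
    finally show "x \<in> span D" .
  next
    fix x assume "x \<in> D"
    then obtain i where i: "i \<in> F" "i \<noteq> f0" "x = axis i 1 - axis f0 1" by (auto simp: D_def)
    then obtain A where A: "A \<subseteq> F - {i, f0}" "card A = k - 1" "insert i A \<notin> \<H>" "insert f0 A \<notin> \<H>"
      using exists_common_part[OF _ f0] by blast
    have B: "C \<union> insert l A \<in> bases" if "l \<in> {i, f0}" for l
    proof -
      have "card (insert l A) = k" using A that rank_ge by (subst card_insert_disjoint) auto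
      then show ?thesis unfolding bases_def
        using A that i f0 by (intro image_eqI[of _ _ "insert l A"]) auto
    qed
    have "x = (- ?a + incidence_vector (C \<union> insert i A)) - (- ?a + incidence_vector (C \<union> insert f0 A))"
      using A i f0 disjoint by (auto simp: vec_eq_iff axis_def)
    also have "\<dots> \<in> span X"
      using B by (intro span_diff span_base) (auto simp: X_def)
    finally show "x \<in> span X" .
  qed
  then have "dim X = dim D" by (metis dim_span)
  moreover have "dim D = card F - 1"
  proof (rule antisym)
    have "dim D \<le> card D" by (rule dim_le_card') (simp add: D_def)
    also have "\<dots> \<le> card (F - {f0})" unfolding D_def by (rule card_image_le) simp
    finally show "dim D \<le> card F - 1" using f0 by simp
    \<comment> \<open>For the lower bound: adding the single vector e_f0 to \<open>D\<close>
      recovers all e_i with i in \<open>F\<close>.\<close>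
    define Y where "Y = (\<lambda>i. axis i 1 :: real ^ 'n) ` F"
    have "independent Y" by (rule independent_mono[OF independent_Basis]) (auto simp: Y_def)
    then have "dim Y = card Y" by (rule dim_eq_card_independent)
    also have "card Y = card F"
      unfolding Y_def by (intro card_image) (auto simp: inj_on_def axis_eq_axis)
    finally have "dim Y = card F" .
    moreover have "Y \<subseteq> span (insert (axis f0 1) D)"
    proof
      fix y assume "y \<in> Y"
      then obtain i where i: "i \<in> F" "y = axis i 1" by (auto simp: Y_def)
      have "axis i 1 - axis f0 1 \<in> span (insert (axis f0 1) D)"
        by (cases "i = f0") (use i in \<open>auto simp: D_def intro: span_zero span_base\<close>)
      then have "axis i 1 - axis f0 1 + axis f0 1 \<in> span (insert (axis f0 1 :: real ^ 'n) D)"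
        by (rule span_add) (simp add: span_base)
      then show "y \<in> span (insert (axis f0 1) D)" using i by simp
    qed
    then have "dim Y \<le> dim (insert (axis f0 1) D)" by (metis dim_subset dim_span)
    ultimately show "card F - 1 \<le> dim D" by (simp add: dim_insert split: if_splits)
  qed
  ultimately show ?thesis using corank_ge by (simp add: of_nat_diff)
qed

section \<open>Lattice points and the Ehrhart polynomial\<close>

text \<open>Coordinates outside \<open>F\<close> are forced to be \<open>t\<close> on coloops and 0
  on loops, so a lattice point is its restriction to \<open>F\<close>.\<close>

lemma card_integer_points:
  "card ((\<lambda>x. real t *\<^sub>R x) ` base_polytope bases \<inter> integer_points) =
    card {f \<in> F \<rightarrow>\<^sub>E {..t}. sum f F = k * t \<and> (\<forall>H\<in>\<H>. sum f H \<le> (k - 1) * t)}" (is "_ = card ?R")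
proof -
  define g :: "('n \<Rightarrow> nat) \<Rightarrow> real ^ 'n"
    where "g f = (\<chi> i. if i \<in> F then real (f i) else if i \<in> C then t else 0)" for f
  define h :: "real ^ 'n \<Rightarrow> 'n \<Rightarrow> nat" where "h x = (\<lambda>i\<in>F. nat \<lfloor>x $ i\<rfloor>)" for x
  have g_sum: "sum (($) (g f)) A = real (sum f A)" if "A \<subseteq> F" for f A
    using that by (auto simp: g_def of_nat_sum intro!: sum.cong)
  have k1: "(real k - 1) * t = real ((k - 1) * t)" using rank_ge by (simp add: of_nat_diff)
  have "bij_betw g ?R (dilate t \<inter> integer_points)"
  proof (rule bij_betwI[where g = h])
    show "g \<in> ?R \<rightarrow> dilate t \<inter> integer_points"
    proof
      fix f assume f: "f \<in> ?R"
      have "sum (($) (g f)) H \<le> (real k - 1) * t" if "H \<in> \<H>" for H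
        unfolding k1 g_sum[OF hyp_subset[OF that]] of_nat_le_iff using f that by blast
      moreover have "sum (($) (g f)) F = k * real t" using f g_sum[of F f] by simp
      ultimately have "g f \<in> dilate t"
        unfolding dilate_def using f disjoint by (auto simp: g_def PiE_def Pi_def)
      moreover have "g f \<in> integer_points" by (auto simp: g_def integer_points_def)
      ultimately show "g f \<in> dilate t \<inter> integer_points" by blast
    qed
    have gh: "g (h x) = x" if x: "x \<in> dilate t \<inter> integer_points" for x
      unfolding vec_eq_iff
    proof
      fix i
      have "x $ i \<in> \<int>" "0 \<le> x $ i" using x by (auto simp: integer_points_def dilate_def)
      then have "real (nat \<lfloor>x $ i\<rfloor>) = x $ i" by (auto elim!: Ints_cases)
      then show "g (h x) $ i = x $ i" using x by (auto simp: g_def h_def dilate_def)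
    qed
    then show "\<And>x. x \<in> dilate t \<inter> integer_points \<Longrightarrow> g (h x) = x" .
    show "h (g f) = f" if "f \<in> ?R" for f
      using that by (auto simp: g_def h_def PiE_def extensional_def fun_eq_iff)
    show "h \<in> dilate t \<inter> integer_points \<rightarrow> ?R"
    proof
      fix x assume x: "x \<in> dilate t \<inter> integer_points"
      have s: "real (sum (h x) A) = sum (($) x) A" if "A \<subseteq> F" for A
        using g_sum[OF that, of "h x"] gh[OF x] by simp
      have "h x i \<le> t" if "i \<in> F" for i
      proof -
        have "x $ i \<le> t" using x by (auto simp: dilate_def)
        then have "\<lfloor>x $ i\<rfloor> \<le> int t" by (metis floor_mono floor_of_nat)
        then show ?thesis using that by (simp add: h_def)
      qed
      then have "h x \<in> F \<rightarrow>\<^sub>E {..t}" by (auto simp: h_def)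
      moreover have "sum (h x) F = k * t"
      proof -
        have "real (sum (h x) F) = real (k * t)" using s[of F] x by (simp add: dilate_def)
        then show ?thesis by (simp only: of_nat_eq_iff)
      qed
      moreover have "sum (h x) H \<le> (k - 1) * t" if "H \<in> \<H>" for H
      proof -
        have "real (sum (h x) H) \<le> real ((k - 1) * t)"
          using s[OF hyp_subset[OF that]] x that k1 by (simp add: dilate_def)
        then show ?thesis by (simp only: of_nat_le_iff)
      qed
      ultimately show "h x \<in> ?R" unfolding mem_Collect_eq by (intro conjI ballI)
    qed
  qed
  then show ?thesis unfolding dilate_eq by (simp add: bij_betw_same_card[symmetric])
qed

lemma is_ehrhart_polynomial_bases:
  assumes "degree (hypersimplex_poly k (card F) - smult (real (card \<H>)) (excess_poly k (card F - k))) = card F - 1"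
  shows "is_ehrhart_polynomial bases
    (hypersimplex_poly k (card F) - smult (real (card \<H>)) (excess_poly k (card F - k)))"
  unfolding is_ehrhart_polynomial_def card_integer_points aff_dim_base_polytope assms
proof (intro conjI allI)
  show "int (card F - 1) = int (card F) - 1" using corank_ge by (simp add: of_nat_diff)
  fix t
  have "k < card F" using corank_ge by simp
  from card_sparse_paving_points[OF finite rank_ge this hyp_subset hyp_card hyp_inter, where t = t and \<H> = \<H>]
  show "poly (hypersimplex_poly k (card F) - smult (real (card \<H>)) (excess_poly k (card F - k))) (real t) =
    real (card {f \<in> F \<rightarrow>\<^sub>E {..t}. sum f F = k * t \<and> (\<forall>H\<in>\<H>. sum f H \<le> (k - 1) * t)})" by simp
qed

section \<open>Complements of bases\<close>

text \<open>Two complements in \<open>F\<close> meet in |F| - 2k + |H \<inter> H'| elements, which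
  is at most (|F| - k) - 2. Loops and coloops change places, and \<open>3 <= k\<close> is what the
  locale demands of the new corank.\<close>

lemma sparse_paving_dual:
  assumes "3 \<le> k"
  shows "sparse_paving (- (C \<union> F)) F (card F - k) ((\<lambda>H. F - H) ` \<H>)"
proof
  show "card F - k \<ge> 2" "card F - k + 3 \<le> card F" using corank_ge assms by auto
next
  fix X assume "X \<in> (\<lambda>H. F - H) ` \<H>"
  then show "card X = card F - k" by (auto simp: card_Diff_subset hyp_card hyp_subset)
next
  fix X Y assume "X \<in> (\<lambda>H. F - H) ` \<H>" "Y \<in> (\<lambda>H. F - H) ` \<H>" "X \<noteq> Y"
  then obtain H H' where H: "H \<in> \<H>" "H' \<in> \<H>" "X = F - H" "Y = F - H'" "H \<noteq> H'" by blast
  have "X \<inter> Y = F - (H \<union> H')" using H by auto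
  then have "card (X \<inter> Y) = card F - card (H \<union> H')"
    using H hyp_subset by (simp add: card_Diff_subset)
  moreover have "card (H \<union> H') + card (H \<inter> H') = 2 * k"
    using card_Un_Int[of H H'] H hyp_card by simp
  ultimately show "card (X \<inter> Y) + 2 \<le> card F - k"
    using hyp_inter[OF H(1,2,5)] corank_ge by linarith
qed auto

lemma bases_dual:
  assumes "3 \<le> k"
  shows "sparse_paving.bases (- (C \<union> F)) F (card F - k) ((\<lambda>H. F - H) ` \<H>) = uminus ` bases"
proof -
  interpret dual: sparse_paving "- (C \<union> F)" F "card F - k" "(\<lambda>H. F - H) ` \<H>"
    by (rule sparse_paving_dual[OF assms])
  have c: "- (C \<union> B) = - (C \<union> F) \<union> (F - B)" "F - (F - B) = B" if "B \<subseteq> F" for B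
    using that disjoint by auto
  have k: "card F - (card F - k) = k" using corank_ge by simp
  show ?thesis
  proof (intro equalityI subsetI)
    fix X assume "X \<in> dual.bases"
    then obtain B where B: "X = - (C \<union> F) \<union> B" "B \<subseteq> F" "card B = card F - k"
      "B \<notin> (\<lambda>H. F - H) ` \<H>" unfolding dual.bases_def by blast
    have "C \<union> (F - B) \<in> bases" unfolding bases_def
      using B c(2)[OF B(2)] k by (intro imageI) (auto simp: card_Diff_subset image_iff)
    moreover have "X = - (C \<union> (F - B))" using B c(1)[of "F - B"] c(2)[OF B(2)] by simp
    ultimately show "X \<in> uminus ` bases" by blast
  next
    fix X assume "X \<in> uminus ` bases"
    then obtain B where B: "X = - (C \<union> B)" "B \<subseteq> F" "card B = k" "B \<notin> \<H>" unfolding bases_def by blast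
    have "F - B \<notin> (\<lambda>H. F - H) ` \<H>"
      using B hyp_subset by (metis (no_types, lifting) double_diff image_iff order_refl)
    then show "X \<in> dual.bases" unfolding dual.bases_def
      using B c(1)[OF B(2)] by (intro image_eqI[of _ _ "F - B"]) (auto simp: card_Diff_subset)
  qed
qed

end

section \<open>Duality\<close>

lemma base_polytope_uminus:
  fixes \<B> :: "'n::finite set set"
  shows "base_polytope (uminus ` \<B>) = (\<lambda>x. 1 - x) ` base_polytope \<B>"
proof -
  have "incidence_vector (- B) = 1 - (incidence_vector B :: real ^ 'n)" for B :: "'n set"
    by (simp add: vec_eq_iff)
  then have "incidence_vector ` uminus ` \<B> = (\<lambda>x. 1 + (- 1) *\<^sub>R x) ` incidence_vector ` \<B>"
    by (simp add: image_image)
  then show ?thesis unfolding base_polytope_def by (simp only: convex_hull_affinity) simp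
qed

text \<open>Complementation reflects the polytope by x -> 1 - x. On the dilate this is x -> t - x in
  each coordinate, an involution preserving the integer lattice.\<close>

lemma is_ehrhart_polynomial_uminus:
  fixes \<B> :: "'n::finite set set"
  assumes "is_ehrhart_polynomial \<B> p"
  shows "is_ehrhart_polynomial (uminus ` \<B>) p"
proof -
  let ?P = "base_polytope \<B>"
  have "(\<lambda>x. 1 - x) ` ?P = (+) 1 ` uminus ` ?P" by (simp add: image_image)
  then have "aff_dim ((\<lambda>x. 1 - x) ` ?P) = aff_dim (uminus ` ?P)" by (simp only: aff_dim_translation_eq)
  also have "\<dots> = aff_dim ?P"
    by (rule aff_dim_injective_linear_image) (auto simp: linear_iff inj_def)
  finally have dim: "aff_dim ((\<lambda>x. 1 - x) ` ?P) = aff_dim ?P" .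
  have "card ((\<lambda>x. real t *\<^sub>R x) ` (\<lambda>x. 1 - x) ` ?P \<inter> integer_points) =
      card ((\<lambda>x. real t *\<^sub>R x) ` ?P \<inter> integer_points)" for t
  proof -
    define g where "g x = real t *\<^sub>R 1 - x" for x :: "real ^ 'n"
    have gg: "g (g x) = x" for x by (simp add: g_def)
    have "(\<lambda>x. real t *\<^sub>R x) ` (\<lambda>x. 1 - x) ` ?P = g ` (\<lambda>x. real t *\<^sub>R x) ` ?P"
      by (simp add: image_image g_def scaleR_diff_right)
    moreover have int: "g x \<in> integer_points" if "x \<in> integer_points" for x
      using that by (auto simp: g_def integer_points_def)
    have "g ` S \<inter> integer_points = g ` (S \<inter> integer_points)" for S
    proof (intro equalityI subsetI)
      fix y assume "y \<in> g ` S \<inter> integer_points"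
      then obtain x where "x \<in> S" "y = g x" "g x \<in> integer_points" by blast
      moreover from this have "x \<in> integer_points" using int[of "g x"] gg by simp
      ultimately show "y \<in> g ` (S \<inter> integer_points)" by blast
    qed (use int in blast)
    ultimately have "(\<lambda>x. real t *\<^sub>R x) ` (\<lambda>x. 1 - x) ` ?P \<inter> integer_points =
      g ` ((\<lambda>x. real t *\<^sub>R x) ` ?P \<inter> integer_points)" by simp
    moreover have "inj_on g S" for S by (metis gg inj_on_inverseI)
    ultimately show ?thesis by (simp add: card_image)
  qed
  then show ?thesis using assms dim
    unfolding is_ehrhart_polynomial_def base_polytope_uminus by simp
qed

section \<open>Families of circuit-hyperplanes\<close>

text \<open>The Graham--Sloane bound: two distinct sets of equal size and equal label sum modulo
  the number of labels cannot differ in a single element.\<close>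

lemma exists_large_hyperplane_family:
  fixes F :: "'a set"
  assumes "finite F" "F \<noteq> {}" "2 \<le> k"
  shows "\<exists>\<H>. (\<forall>H\<in>\<H>. H \<subseteq> F \<and> card H = k) \<and>
    (\<forall>H\<in>\<H>. \<forall>H'\<in>\<H>. H \<noteq> H' \<longrightarrow> card (H \<inter> H') + 2 \<le> k) \<and>
    real (card F choose k) / real (card F) \<le> real (card \<H>) \<and> card \<H> \<le> card F choose k"
proof -
  define n where "n = card F"
  have n: "n > 0" using assms by (simp add: n_def card_gt_0_iff)
  obtain \<phi> :: "'a \<Rightarrow> nat" where \<phi>: "bij_betw \<phi> F {0..<n}"
    unfolding n_def using ex_bij_betw_finite_nat[OF assms(1)] by blast
  define s where "s S = (\<Sum>i\<in>S. int (\<phi> i)) mod int n" for S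
  define K where "K = {S. S \<subseteq> F \<and> card S = k}"
  have finK: "finite K" using assms by (simp add: K_def)
  have cardK: "card K = n choose k" using assms by (simp add: K_def n_def n_subsets)
  define fam where "fam r = {S \<in> K. s S = r}" for r
  have "K = (\<Union>r\<in>{0..<int n}. fam r)" using n by (auto simp: fam_def s_def)
  then have "card K = (\<Sum>r\<in>{0..<int n}. card (fam r))"
    using finK by (simp only:) (intro card_UN_disjoint; auto simp: fam_def)
  \<comment> \<open>Pigeonhole over the \<open>n\<close> residue classes: some class has at least
    the average size.\<close>
  moreover have "\<exists>r\<in>{0..<int n}. card K \<le> n * card (fam r)"
  proof (rule ccontr)
    assume "\<not> ?thesis"
    then have "(\<Sum>r\<in>{0..<int n}. n * card (fam r)) < (\<Sum>r\<in>{0..<int n}. card K)"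
      using n by (intro sum_strict_mono) (auto simp: not_le)
    then show False using calculation by (simp add: sum_distrib_left[symmetric])
  qed
  then obtain r where r: "card K \<le> n * card (fam r)" by blast
  have "card (H \<inter> H') + 2 \<le> k" if H: "H \<in> fam r" "H' \<in> fam r" "H \<noteq> H'" for H H'
  proof (rule ccontr)
    assume neg: "\<not> ?thesis"
    have fin: "finite H" "finite H'" using H assms finite_subset by (auto simp: fam_def K_def)
    have c: "card H = k" "card H' = k" using H by (auto simp: fam_def K_def)
    have "\<not> H \<subseteq> H'" "\<not> H' \<subseteq> H" using H(3) c fin by (metis card_subset_eq)+
    then have "card (H - H') > 0" "card (H' - H) > 0" using fin by (auto simp: card_gt_0_iff)
    moreover have "card (H - H') = k - card (H \<inter> H')" "card (H' - H) = k - card (H \<inter> H')"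
      using fin c by (simp_all add: card_Diff_subset_Int Int_commute)
    ultimately have "card (H - H') = 1" "card (H' - H) = 1" using neg by linarith+
    then obtain x y where xy: "H - H' = {x}" "H' - H = {y}" by (auto simp: card_1_singleton_iff)
    have "x \<in> F" "y \<in> F" "x \<noteq> y" using xy H by (auto simp: fam_def K_def)
    have "H = insert x (H \<inter> H')" "H' = insert y (H \<inter> H')" using xy by auto
    then have "(\<Sum>i\<in>H. int (\<phi> i)) = int (\<phi> x) + (\<Sum>i\<in>H \<inter> H'. int (\<phi> i))"
      "(\<Sum>i\<in>H'. int (\<phi> i)) = int (\<phi> y) + (\<Sum>i\<in>H \<inter> H'. int (\<phi> i))"
      using xy fin by (metis (no_types, lifting) DiffD2 IntD1 IntD2 finite_Int insertI1 sum.insert)+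
    moreover have "s H = s H'" using H by (simp add: fam_def)
    ultimately have "int n dvd int (\<phi> x) - int (\<phi> y)"
      unfolding s_def by (simp add: mod_eq_dvd_iff)
    moreover have "\<phi> x < n" "\<phi> y < n" using \<phi> \<open>x \<in> F\<close> \<open>y \<in> F\<close> by (auto dest: bij_betwE)
    ultimately have "\<phi> x = \<phi> y"
      using zdvd_not_zless[of "int (\<phi> x) - int (\<phi> y)" "int n"]
        zdvd_not_zless[of "int (\<phi> y) - int (\<phi> x)" "int n"]
      by (smt (verit) dvd_diff_commute of_nat_0_le_iff of_nat_eq_iff of_nat_less_iff)
    then show False using \<phi> \<open>x \<in> F\<close> \<open>y \<in> F\<close> \<open>x \<noteq> y\<close> by (auto simp: bij_betw_def inj_on_def)
  qed
  moreover have "real (n choose k) / real n \<le> real (card (fam r))"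
  proof -
    have "real (n choose k) \<le> real n * real (card (fam r))"
      using r unfolding cardK of_nat_mult[symmetric] of_nat_le_iff .
    then show ?thesis using n by (simp add: field_simps)
  qed
  moreover have "card (fam r) \<le> n choose k"
    unfolding cardK[symmetric] using finK by (intro card_mono) (auto simp: fam_def)
  moreover have "\<forall>H\<in>fam r. H \<subseteq> F \<and> card H = k" by (auto simp: fam_def K_def)
  ultimately show ?thesis unfolding n_def by (intro exI[of _ "fam r"]) blast
qed

text \<open>There are \<open>c\<close> coloops and \<open>l\<close> loops around a sparse paving
  matroid of rank \<open>k\<close> and corank \<open>m\<close>; duality exchanges \<open>c\<close>
  with \<open>l\<close> and \<open>k\<close> with \<open>m\<close>, which gives the second
  rank.\<close>

lemma exists_not_ehrhart_positive_matroid: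
  assumes k: "3 \<le> k" and m: "3 \<le> m"
    and neg: "\<And>l. real (m + k choose k) / real (m + k) \<le> l \<Longrightarrow>
      coeff (hypersimplex_poly k (m + k) - smult l (excess_poly k m)) 3 < 0"
    and deg: "\<And>l. l \<le> real (m + k choose k) \<Longrightarrow>
      degree (hypersimplex_poly k (m + k) - smult l (excess_poly k m)) = m + k - 1"
    and card: "card (UNIV :: 'n::finite set) = c + l + (m + k)"
  shows "\<exists>\<B> :: 'n set set. matroid UNIV \<B> \<and> matroid_rank \<B> = c + k \<and> \<not> ehrhart_positive \<B>" (is ?primal)
    and "\<exists>\<B> :: 'n set set. matroid UNIV \<B> \<and> matroid_rank \<B> = l + m \<and> \<not> ehrhart_positive \<B>" (is ?dual)
proof -
  obtain F :: "'n set" where F: "card F = m + k"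
    using obtain_subset_with_card_n[of "m + k" "UNIV :: 'n set"] card by auto
  have compl: "card (- A) = card (UNIV :: 'n set) - card A" for A :: "'n set"
    by (simp add: Compl_eq_Diff_UNIV card_Diff_subset)
  have "card (- F) = c + l" using F card by (simp add: compl)
  then obtain C where C: "C \<subseteq> - F" "card C = c"
    using obtain_subset_with_card_n[of c "- F"] by auto
  obtain \<H> where H: "\<forall>H\<in>\<H>. H \<subseteq> F \<and> card H = k"
    "\<forall>H\<in>\<H>. \<forall>H'\<in>\<H>. H \<noteq> H' \<longrightarrow> card (H \<inter> H') + 2 \<le> k"
    "real (m + k choose k) / real (m + k) \<le> real (card \<H>)" "card \<H> \<le> m + k choose k"
    using exists_large_hyperplane_family[of F k] F k by force
  interpret sparse_paving C F k \<H>
    using C F H k m by unfold_locales auto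
  define p where "p = hypersimplex_poly k (m + k) - smult (real (card \<H>)) (excess_poly k m)"
  have "degree p = m + k - 1" unfolding p_def using H by (intro deg) simp
  then have ehr: "is_ehrhart_polynomial bases p"
    using is_ehrhart_polynomial_bases F by (simp add: p_def)
  have np: "\<not> ehrhart_positive \<B>" if "is_ehrhart_polynomial \<B> p" for \<B> :: "'n set set"
  proof -
    have "int 3 \<le> aff_dim (base_polytope \<B>)"
      using that \<open>degree p = m + k - 1\<close> k m unfolding is_ehrhart_polynomial_def by linarith
    moreover have "coeff p 3 < 0" unfolding p_def by (rule neg) (rule H)
    ultimately show ?thesis
      unfolding ehrhart_positive_def ehrhart_polynomial_eqI[OF that] by (metis less_asym)
  qed
  show ?primal
    using matroid_bases matroid_rank_bases np[OF ehr] C by auto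
  interpret dual: sparse_paving "- (C \<union> F)" F "card F - k" "(\<lambda>H. F - H) ` \<H>"
    by (rule sparse_paving_dual[OF k])
  have "card (C \<union> F) = c + (m + k)" using C F by (subst card_Un_disjoint) auto
  then have "card (- (C \<union> F)) = l" using card compl[of "C \<union> F"] by linarith
  then have "matroid_rank dual.bases = l + m" using dual.matroid_rank_bases F by simp
  then show ?dual
    using dual.matroid_bases np[OF is_ehrhart_polynomial_uminus[OF ehr]] bases_dual[OF k] by auto
qed

theorem theorem6p4:
  fixes n k :: nat
  assumes card_ground: "card (UNIV :: 'n::finite set) = n"
  shows "(n \<ge> 3589 \<and> 3 \<le> k \<and> k \<le> n - 3 \<longrightarrow>
            (\<exists>\<B> :: 'n set set. matroid UNIV \<B> \<and> matroid_rank \<B> = k \<and> \<not> ehrhart_positive \<B>))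
       \<and> (n \<ge> 104 \<and> 4 \<le> k \<and> k \<le> n - 4 \<longrightarrow>
            (\<exists>\<B> :: 'n set set. matroid UNIV \<B> \<and> matroid_rank \<B> = k \<and> \<not> ehrhart_positive \<B>))"
proof -
  let ?ex = "\<lambda>k. \<exists>\<B> :: 'n set set. matroid UNIV \<B> \<and> matroid_rank \<B> = k \<and> \<not> ehrhart_positive \<B>"
  have ex: "?ex k"
    if "(k\<^sub>0, m) \<in> {(3, 3586), (4, 100), (5, 52)}"
      "k\<^sub>0 \<le> k \<and> k + m \<le> n \<or> m \<le> k \<and> k + k\<^sub>0 \<le> n" for k k\<^sub>0 m
  proof -
    have neg: "coeff (hypersimplex_poly k\<^sub>0 (m + k\<^sub>0) - smult l (excess_poly k\<^sub>0 m)) 3 < 0"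
      if "real (m + k\<^sub>0 choose k\<^sub>0) / real (m + k\<^sub>0) \<le> l" for l
      using \<open>(k\<^sub>0, m) \<in> _\<close> that coeff_3_negative_3_3586[of l] coeff_3_negative_4_100[of l]
        coeff_3_negative_5_52[of l] by auto
    have deg: "degree (hypersimplex_poly k\<^sub>0 (m + k\<^sub>0) - smult l (excess_poly k\<^sub>0 m)) = m + k\<^sub>0 - 1"
      if "l \<le> real (m + k\<^sub>0 choose k\<^sub>0)" for l
      using \<open>(k\<^sub>0, m) \<in> _\<close> that degree_3_3586[of l] degree_4_100[of l] degree_5_52[of l] by auto
    have km: "3 \<le> k\<^sub>0" "3 \<le> m" using that(1) by auto
    show ?thesis
      using that(2)
    proof
      \<comment> \<open>The rank is raised by \<open>k - k\<^sub>0\<close> coloops; the other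
        \<open>n - m - k\<close> added elements are loops.\<close>
      assume "k\<^sub>0 \<le> k \<and> k + m \<le> n"
      then show ?thesis
        using exists_not_ehrhart_positive_matroid(1)[OF km neg deg, of "k - k\<^sub>0" "n - m - k"] card_ground
        by simp
    next
      \<comment> \<open>Here the dual has rank \<open>m\<close> plus the number of loops, so
        \<open>k - m\<close> loops are taken and the rest are coloops.\<close>
      assume "m \<le> k \<and> k + k\<^sub>0 \<le> n"
      then show ?thesis
        using exists_not_ehrhart_positive_matroid(2)[OF km neg deg, of "n - k\<^sub>0 - k" "k - m"] card_ground
        by simp
    qed
  qed
  have four: "?ex k" if "n \<ge> 104" "4 \<le> k" "k \<le> n - 4" for k
  proof -
    \<comment> \<open>Apart from the extreme ranks, either \<open>k + 52 <= n\<close> or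
      \<open>52 <= k\<close>, because \<open>n >= 104\<close>.\<close>
    have "k = 4 \<or> k = n - 4 \<or> 5 \<le> k \<and> k + 52 \<le> n \<or> 52 \<le> k \<and> k + 5 \<le> n"
      using that by arith
    then consider "k = 4" | "k = n - 4" | "5 \<le> k" "k + 52 \<le> n" | "52 \<le> k" "k + 5 \<le> n"
      by blast
    then show ?thesis
    proof cases
      case 1
      then show ?thesis using that by (intro ex[where k\<^sub>0 = 4 and m = 100]) auto
    next
      case 2
      then show ?thesis using that by (intro ex[where k\<^sub>0 = 4 and m = 100]) auto
    next
      case 3
      then show ?thesis by (intro ex[where k\<^sub>0 = 5 and m = 52]) auto
    next
      case 4
      then show ?thesis by (intro ex[where k\<^sub>0 = 5 and m = 52]) auto
    qed
  qed
  moreover have "?ex k" if "n \<ge> 3589" "3 \<le> k" "k \<le> n - 3" for k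
  proof -
    have "k = 3 \<or> k = n - 3 \<or> 4 \<le> k \<and> k \<le> n - 4" using that by arith
    then consider "k = 3" | "k = n - 3" | "4 \<le> k" "k \<le> n - 4" by blast
    then show ?thesis
    proof cases
      case 1
      then show ?thesis using that by (intro ex[where k\<^sub>0 = 3 and m = 3586]) auto
    next
      case 2
      then show ?thesis using that by (intro ex[where k\<^sub>0 = 3 and m = 3586]) auto
    next
      case 3
      then show ?thesis using that by (intro four) auto
    qed
  qed
  ultimately show ?thesis by blast
qed

end
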